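(* In the setting of the context, with $\rho$ the principal eigenvalue defined there, \[ \rho=\inf_{g\in C^2_\gamma(\bar Q)}\ \sup_{\mu\in\mathcal{P}(\bar Q\times\mathcal{K}\times\mathbb{R}^d)}F(g,\mu)=\sup_{\mu\in\mathcal{P}(\bar Q\times\mathcal{K}\times\mathbb{R}^d)}\ \inf_{g\in C^2_\gamma(\bar Q)}F(g,\mu). \] Moreover, these equalities remain valid when $\mathcal{P}(\bar Q\times\mathcal{K}\times\mathbb{R}^d)$ is replaced with $\mathfrak{M}_{\mathcal{A},Q}$, and thus \[ \rho=\sup_{\mu\in\mathfrak{M}_{\mathcal{A},Q}}\int_{\bar Q\times\mathcal{K}\times\mathbb{R}^d}\mathcal{R}(x,\xi,y)\,\mu(\mathrm{d}x,\mathrm{d}\xi,\mathrm{d}y). \]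
   Context: Let $Q\subset\mathbb{R}^d$ be a bounded $C^2$ domain with $0\in Q$, and $\mathcal{K}$ a compact metrizable space. Let $b\colon\bar Q\times\mathcal{K}\to\mathbb{R}^d$ be continuous and Lipschitz in $x$ uniformly in $\xi$; let $\sigma\colon\bar Q\to\mathbb{R}^{d\times d}$ be continuously differentiable with Hölder continuous derivatives, such that the minimum eigenvalue of $a=\sigma\sigma^{\mathsf T}$ is bounded away from zero on $Q$; let $\gamma_i(x)=\sum_j a^{ij}(x)n_j(x)$ on $\partial Q$ be the co-normal direction ($\vec n$ the outward unit normal). Let $c\colon\bar Q\times\mathcal{K}\to\mathbb{R}$ be continuous and Lipschitz in $x$ uniformly in $\xi$. Let $C^2_\gamma(\bar Q)=\{f\in C^2(\bar Q):\langle\nabla f,\gamma\rangle=0\text{ on }\partial Q\}$ and $C^2_{\gamma,+}(\bar Q)$ its nonnegative elements. Let $\mathcal{G}f(x)=\tfrac12\operatorname{tr}(a(x)\nabla^2f(x))+\max_{\xi\in\mathcal{K}}[\langle b(x,\xi),\nabla f(x)\rangle+c(x,\xi)f(x)]$. It is known that there is a unique pair $(\rho,V)\in\mathbb{R}\times C^2_{\gamma,+}(\bar Q)$ with $\mathcal{G}V=\rho V$ in $Q$, $\langle\nabla V,\gamma\rangle=0$ on $\partial Q$, and $V(0)=1$; $\rho$ is this number. Define $\mathcal{R}(x,\xi,y)=c(x,\xi)-\tfrac12|\sigma^{\mathsf T}(x)y|^2$ and $\mathcal{A}\phi(x,\xi,y)=\tfrac12\operatorname{tr}(a(x)\nabla^2\phi(x))+\langle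 b(x,\xi)+a(x)y,\nabla\phi(x)\rangle$ for $\phi\in C^2_\gamma(\bar Q)$. For $g\in C^2_\gamma(\bar Q)$ and $\mu\in\mathcal{P}(\bar Q\times\mathcal{K}\times\mathbb{R}^d)$ (Borel probability measures), $F(g,\mu)=\int(\mathcal{A}g+\mathcal{R})\,\mathrm{d}\mu$. Let $\mathfrak{M}_{\mathcal{A},Q}$ be the set of $\mu\in\mathcal{P}(\bar Q\times\mathcal{K}\times\mathbb{R}^d)$ with $\int|\mathcal{A}f|\,\mathrm{d}\mu<\infty$ and $\int\mathcal{A}f\,\mathrm{d}\mu=0$ for all $f\in C^2_\gamma(\bar Q)$. *)

theory Defs
  imports "HOL-Analysis.Analysis"
begin

definition C2_on :: "(real^'n) set \<Rightarrow> (real^'n \<Rightarrow> real) \<Rightarrow> (real^'n \<Rightarrow> real^'n)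
    \<Rightarrow> (real^'n \<Rightarrow> real^'n^'n) \<Rightarrow> bool" where
  "C2_on S f Df D2f \<longleftrightarrow> open S \<and>
     continuous_on S f \<and> continuous_on S Df \<and> continuous_on S D2f \<and>
     (\<forall>x\<in>S. (f has_derivative (\<lambda>h. Df x \<bullet> h)) (at x)) \<and>
     (\<forall>x\<in>S. (Df has_derivative (\<lambda>h. D2f x *v h)) (at x))"

text \<open>C^2(closure Q): C^2 in Q with f, gradient and Hessian extending
  continuously to the closure (Df, D2f on the boundary are these extensions).\<close>
definition C2_closure :: "(real^'n) set \<Rightarrow> (real^'n \<Rightarrow> real) \<Rightarrow> (real^'n \<Rightarrow> real^'n)
    \<Rightarrow> (real^'n \<Rightarrow> real^'n^'n) \<Rightarrow> bool" where
  "C2_closure Q f Df D2f \<longleftrightarrow>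
     continuous_on (closure Q) f \<and> continuous_on (closure Q) Df \<and> continuous_on (closure Q) D2f \<and>
     (\<forall>x\<in>Q. (f has_derivative (\<lambda>h. Df x \<bullet> h)) (at x)) \<and>
     (\<forall>x\<in>Q. (Df has_derivative (\<lambda>h. D2f x *v h)) (at x))"

definition local_defining_fun :: "(real^'n) set \<Rightarrow> real^'n \<Rightarrow> real \<Rightarrow> (real^'n \<Rightarrow> real)
    \<Rightarrow> (real^'n \<Rightarrow> real^'n) \<Rightarrow> (real^'n \<Rightarrow> real^'n^'n) \<Rightarrow> bool" where
  "local_defining_fun Q p r \<phi> D\<phi> D2\<phi> \<longleftrightarrow> r > 0 \<and> C2_on (ball p r) \<phi> D\<phi> D2\<phi> \<and>
     Q \<inter> ball p r = {x \<in> ball p r. \<phi> x < 0} \<and> (\<forall>x\<in>ball p r. D\<phi> x \<noteq> 0)"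

definition C2_domain :: "(real^'n) set \<Rightarrow> bool" where
  "C2_domain Q \<longleftrightarrow> open Q \<and> connected Q \<and> Q \<noteq> {} \<and>
     (\<forall>p\<in>frontier Q. \<exists>r \<phi> D\<phi> D2\<phi>. local_defining_fun Q p r \<phi> D\<phi> D2\<phi>)"

definition outward_normal :: "(real^'n) set \<Rightarrow> real^'n \<Rightarrow> real^'n \<Rightarrow> bool" where
  "outward_normal Q p v \<longleftrightarrow> p \<in> frontier Q \<and>
     (\<exists>r \<phi> D\<phi> D2\<phi>. local_defining_fun Q p r \<phi> D\<phi> D2\<phi> \<and> v = (1 / norm (D\<phi> p)) *\<^sub>R D\<phi> p)"

definition diffmat :: "(real^'n \<Rightarrow> real^'n^'n) \<Rightarrow> real^'n \<Rightarrow> real^'n^'n" where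
  "diffmat \<sigma> x = \<sigma> x ** transpose (\<sigma> x)"

definition C2_gamma :: "(real^'n) set \<Rightarrow> (real^'n \<Rightarrow> real^'n^'n) \<Rightarrow>
    ((real^'n \<Rightarrow> real) \<times> (real^'n \<Rightarrow> real^'n) \<times> (real^'n \<Rightarrow> real^'n^'n)) set" where
  "C2_gamma Q \<sigma> = {(f, Df, D2f). C2_closure Q f Df D2f \<and>
     (\<forall>p v. outward_normal Q p v \<longrightarrow> Df p \<bullet> (diffmat \<sigma> p *v v) = 0)}"

definition opA :: "(real^'n \<Rightarrow> real^'n^'n) \<Rightarrow> (real^'n \<Rightarrow> 'k \<Rightarrow> real^'n)
    \<Rightarrow> (real^'n \<Rightarrow> real^'n) \<Rightarrow> (real^'n \<Rightarrow> real^'n^'n) \<Rightarrow> ((real^'n) \<times> 'k \<times> (real^'n)) \<Rightarrow> real" where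
  "opA \<sigma> b D\<phi> D2\<phi> z = (case z of (x, \<xi>, y) \<Rightarrow>
     trace (diffmat \<sigma> x ** D2\<phi> x) / 2 + (b x \<xi> + diffmat \<sigma> x *v y) \<bullet> D\<phi> x)"

definition runR :: "(real^'n \<Rightarrow> real^'n^'n) \<Rightarrow> (real^'n \<Rightarrow> 'k \<Rightarrow> real)
    \<Rightarrow> ((real^'n) \<times> 'k \<times> (real^'n)) \<Rightarrow> real" where
  "runR \<sigma> c z = (case z of (x, \<xi>, y) \<Rightarrow> c x \<xi> - (norm (transpose (\<sigma> x) *v y))\<^sup>2 / 2)"

definition eint :: "'a measure \<Rightarrow> 'a set \<Rightarrow> ('a \<Rightarrow> real) \<Rightarrow> ereal" where
  "eint M S f = enn2ereal (\<integral>\<^sup>+ z. ennreal (f z) * indicator S z \<partial>M)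
               - enn2ereal (\<integral>\<^sup>+ z. ennreal (- f z) * indicator S z \<partial>M)"

text \<open>Borel probability measures on closure Q \<times> K \<times> R^d (as Borel probability
  measures on the ambient product space carried by this set).\<close>
definition probs :: "(real^'n) set \<Rightarrow> 'k::topological_space set \<Rightarrow> ((real^'n) \<times> 'k \<times> (real^'n)) measure set" where
  "probs Q K = {\<mu>. emeasure \<mu> (space \<mu>) = 1 \<and> sets \<mu> = sets borel \<and> emeasure \<mu> (closure Q \<times> K \<times> UNIV) = 1}"

definition funcF where
  "funcF Q K \<sigma> b c g \<mu> = (case g of (f, Df, D2f) \<Rightarrow>
      eint \<mu> (closure Q \<times> K \<times> UNIV) (\<lambda>z. opA \<sigma> b Df D2f z + runR \<sigma> c z))"

definition MAQ :: "(real^'n) set \<Rightarrow> 'k::topological_space set \<Rightarrow> (real^'n \<Rightarrow> real^'n^'n)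
    \<Rightarrow> (real^'n \<Rightarrow> 'k \<Rightarrow> real^'n) \<Rightarrow> ((real^'n) \<times> 'k \<times> (real^'n)) measure set" where
  "MAQ Q K \<sigma> b = {\<mu> \<in> probs Q K. \<forall>(f, Df, D2f) \<in> C2_gamma Q \<sigma>.
      set_integrable \<mu> (closure Q \<times> K \<times> UNIV) (opA \<sigma> b Df D2f) \<and>
      (LINT z:(closure Q \<times> K \<times> UNIV)|\<mu>. opA \<sigma> b Df D2f z) = 0}"

end

theory Submission
  imports Defs "HOL-Probability.Probability"
begin

text \<open>
  By Hopf's lemma the eigenfunction \<open>V\<close> is positive on the closed domain, so \<open>\<phi> = ln V\<close> is an admissible test
  function, and completing the square in \<open>y\<close> turns the eigenvalue equation into \<open>\<A>\<phi> + \<R> \<le> \<rho>\<close>, with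
  equality on the compact set \<open>M\<close> of points \<open>(x, \<xi>, \<nabla>\<phi>(x))\<close> where \<open>\<xi>\<close> is a maximising control at \<open>x\<close>. It
  remains to find a probability measure \<open>\<nu>\<close> on \<open>M\<close> that annihilates all \<open>\<A>f\<close>: the pair \<open>(\<phi>, \<nu>)\<close> is then a
  saddle point. Such a measure exists because no \<open>\<A>f\<close> is negative throughout \<open>M\<close>, as one sees at a minimum
  of \<open>f\<close>, where thanks to the conormal condition even on the boundary the gradient vanishes and the Hessian
  is nonnegative. It is a weak limit of empirical measures of points chosen by Blackwell's approachability
  argument.
\<close>

section \<open>Probability measures annihilating a space of continuous functions\<close>

text \<open>Neither variable of \<open>F\<close> ranges over a compact set, \<open>y\<close> is
  unbounded and \<open>F\<close> may be minus infinity, so no minimax theorem is invoked: a saddle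
  pair yields the equalities directly. As \<open>\<nu>\<close> satisfies the constraints of
  \<open>MAQ\<close>, one pair serves both classes of measures. Two nonpositive terms separate
  \<A>\<phi> + \<R> from \<rho>: the residual of the eigenvalue equation at the control \<xi>,
  divided by \<open>V\<close>, and minus half the square left over in \<open>y\<close>. The set M is
  exactly where both vanish. The existence of \<nu> is a theorem of the alternative. Separation and
  Riesz representation would give it abstractly; here finitely many test functions at a time are
  averaged to almost zero along a sequence of points. For the weak limit the points are lifted to a
  compact set of reals, where tightness yields a convergent subsequence; the ternary coding provides
  that lift. The maximum over controls makes the eigenvalue equation nonlinear. For Hopf's lemma a
  single control is frozen, which leaves a linear differential inequality for
  \<open>V\<close>.\<close>

lemma ternary_digit_sum_separation:
  fixes a b :: "nat \<Rightarrow> real"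
  assumes a: "\<And>n. a n \<in> {0, 1}" and b: "\<And>n. b n \<in> {0, 1}"
    and diff: "\<bar>(\<Sum>n. 2 * a n / 3 ^ Suc n) - (\<Sum>n. 2 * b n / 3 ^ Suc n)\<bar> < 1 / 3 ^ Suc N"
    and "n \<le> N"
  shows "a n = b n"
proof (rule ccontr)
  assume "a n \<noteq> b n"
  define i where "i = (LEAST i. a i \<noteq> b i)"
  have i: "a i \<noteq> b i" unfolding i_def using \<open>a n \<noteq> b n\<close> by (rule LeastI)
  have less: "a j = b j" if "j < i" for j
    using not_less_Least[of j "\<lambda>i. a i \<noteq> b i"] that unfolding i_def by auto
  have "i \<le> n" unfolding i_def using \<open>a n \<noteq> b n\<close> by (rule Least_le)
  define d where "d n = 2 * (a n - b n) / 3 ^ Suc n" for n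
  have geo: "(\<lambda>n. 2 / 3 ^ Suc (n + m) :: real) sums (1 / 3 ^ m)" for m
  proof -
    have "(\<lambda>n. (1/3) ^ n :: real) sums (1 / (1 - 1/3))"
      by (rule geometric_sums) simp
    then have "(\<lambda>n. 2 / 3 ^ Suc m * (1/3) ^ n :: real) sums (2 / 3 ^ Suc m * (1 / (1 - 1/3)))"
      by (rule sums_mult)
    then show ?thesis by (simp add: power_add field_simps)
  qed
  have summ: "summable (\<lambda>n. 2 * u n / 3 ^ Suc n)" if "\<And>n. u n \<in> {0, 1::real}" for u
  proof (rule summable_comparison_test_ev)
    show "\<forall>\<^sub>F n in sequentially. norm (2 * u n / 3 ^ Suc n) \<le> 2 / 3 ^ Suc n"
    proof (rule always_eventually, rule allI)
      fix n show "norm (2 * u n / 3 ^ Suc n) \<le> 2 / 3 ^ Suc n"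
        using that[of n] by auto
    qed
    show "summable (\<lambda>n. 2 / 3 ^ Suc n :: real)"
      using geo[of 0] by (auto simp: sums_iff)
  qed
  have d_eq: "d = (\<lambda>n. 2 * a n / 3 ^ Suc n - 2 * b n / 3 ^ Suc n)"
    by (simp add: fun_eq_iff d_def diff_divide_distrib right_diff_distrib)
  have sa: "summable (\<lambda>n. 2 * a n / 3 ^ Suc n)" and sb: "summable (\<lambda>n. 2 * b n / 3 ^ Suc n)"
    using summ a b by auto
  have dsum: "summable d"
    unfolding d_eq by (rule summable_diff[OF sa sb])
  have deq: "suminf d = (\<Sum>n. 2 * a n / 3 ^ Suc n) - (\<Sum>n. 2 * b n / 3 ^ Suc n)"
    unfolding d_eq by (rule suminf_diff[OF sa sb, symmetric])
  \<comment> \<open>Before the first disagreement \<open>i\<close> everything cancels, at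
    \<open>i\<close> the sums differ by \<open>2 / 3 ^ Suc i\<close>, and all later digits together
    recover at most half of that. Base 3 with digits 0 and 2 leaves this gap; binary digits would
    not.\<close>
  have "suminf d = (\<Sum>n. d (n + Suc i)) + (\<Sum>j<Suc i. d j)"
    by (rule suminf_split_initial_segment[OF dsum])
  also have "(\<Sum>j<Suc i. d j) = d i"
    using less by (simp add: d_def)
  finally have split: "suminf d = (\<Sum>n. d (n + Suc i)) + d i" .
  have bound: "\<bar>d (n + Suc i)\<bar> \<le> 2 / 3 ^ Suc (n + Suc i)" for n
    using a[of "n + Suc i"] b[of "n + Suc i"] by (auto simp: d_def simp del: power_Suc)
  have "\<bar>\<Sum>n. d (n + Suc i)\<bar> \<le> (\<Sum>n. 2 / 3 ^ Suc (n + Suc i))"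
    using norm_suminf_le[of "\<lambda>n. d (n + Suc i)" "\<lambda>n. 2 / 3 ^ Suc (n + Suc i)"] bound geo[of "Suc i"]
    by (simp add: sums_iff del: power_Suc)
  also have "\<dots> = 1 / 3 ^ Suc i" using geo[of "Suc i"] by (simp add: sums_iff del: power_Suc)
  finally have tail: "\<bar>\<Sum>n. d (n + Suc i)\<bar> \<le> 1 / 3 ^ Suc i" .
  have "\<bar>d i\<bar> = 2 / 3 ^ Suc i"
    using i a[of i] b[of i] by (auto simp: d_def)
  with split tail have "\<bar>suminf d\<bar> \<ge> 1 / 3 ^ Suc i" by linarith
  moreover have "(1::real) / 3 ^ Suc N \<le> 1 / 3 ^ Suc i"
    using \<open>i \<le> n\<close> \<open>n \<le> N\<close> by (intro divide_left_mono power_increasing) auto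
  ultimately show False using diff deq by linarith
qed

text \<open>A point is encoded by its membership pattern in a countable family of balls, read as ternary digits. The
  code need not be continuous, but its inverse is uniformly so; the closure of the graph extends it to a compact
  set of reals.\<close>
theorem compact_metric_image_of_real_compact:
  fixes M :: "'a::metric_space set"
  assumes M: "compact M" "M \<noteq> {}"
  obtains C :: "real set" and \<psi> where "compact C" "continuous_on C \<psi>" "\<psi> ` C = M"
proof -
  have "\<forall>m. \<exists>T. finite T \<and> M \<subseteq> (\<Union>x\<in>T. ball x (1 / real (Suc m)))"
  proof
    fix m :: nat
    have "0 < 1 / real (Suc m)" by simp
    with M(1) show "\<exists>T. finite T \<and> M \<subseteq> (\<Union>x\<in>T. ball x (1 / real (Suc m)))"
      unfolding compact_eq_totally_bounded by blast
  qed
  then obtain T where T: "\<And>m. finite (T m)" "\<And>m. M \<subseteq> (\<Union>x\<in>T m. ball x (1 / real (Suc m)))"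
    by metis
  define B where "B = (\<Union>m. T m \<times> {m})"
  have cB: "countable B" unfolding B_def using T(1) by (intro countable_UN) (auto intro: countable_finite)
  have "B \<noteq> {}" using T(2)[of 0] M(2) unfolding B_def by blast
  define U where "U n = ball (fst (from_nat_into B n)) (1 / real (Suc (snd (from_nat_into B n))))" for n
  define a :: "'a \<Rightarrow> nat \<Rightarrow> real" where "a p n = (if p \<in> U n then 1 else 0)" for p n
  define e where "e p = (\<Sum>n. 2 * a p n / 3 ^ Suc n)" for p
  have a01: "a p n \<in> {0, 1}" for p n by (simp add: a_def)
  have uc: "\<exists>\<delta>>0. \<forall>p\<in>M. \<forall>q\<in>M. \<bar>e p - e q\<bar> < \<delta> \<longrightarrow> dist p q < \<epsilon>" if eps: "\<epsilon> > 0" for \<epsilon>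
  proof -
    obtain m where m: "1 / real (Suc m) < \<epsilon> / 2"
      using reals_Archimedean[of "\<epsilon> / 2"] eps by (auto simp: inverse_eq_divide)
    \<comment> \<open>The finitely many balls of scale \<open>m\<close> all have codes up to
      \<open>N\<close>. Agreement of the digits up to \<open>N\<close> therefore puts
      \<open>q\<close> into the same small ball as \<open>p\<close>.\<close>
    define N where "N = Max ((\<lambda>x. to_nat_on B (x, m)) ` T m)"
    have "dist p q < \<epsilon>" if p: "p \<in> M" and q: "q \<in> M" and d: "\<bar>e p - e q\<bar> < 1 / 3 ^ Suc N" for p q
    proof -
      obtain x where x: "x \<in> T m" "p \<in> ball x (1 / real (Suc m))" using T(2)[of m] p by auto
      have "(x, m) \<in> B" using x by (auto simp: B_def)
      define n where "n = to_nat_on B (x, m)"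
      have "n \<le> N" unfolding N_def n_def using T(1)[of m] x by (intro Max_ge) auto
      have "from_nat_into B n = (x, m)" unfolding n_def using cB \<open>(x, m) \<in> B\<close> by simp
      then have Un: "U n = ball x (1 / real (Suc m))" by (simp add: U_def)
      have "a p n = a q n"
        using ternary_digit_sum_separation[OF a01 a01 d[unfolded e_def] \<open>n \<le> N\<close>] .
      then have "q \<in> ball x (1 / real (Suc m))" using x Un by (auto simp: a_def split: if_splits)
      then have "dist p q < 1 / real (Suc m) + 1 / real (Suc m)"
        using x dist_triangle[of p q x] by (simp add: dist_commute)
      with m show ?thesis by linarith
    qed
    then show ?thesis by (intro exI[of _ "1 / 3 ^ Suc N"]) auto
  qed
  have e01: "e p \<in> {0..1}" for p
  proof -
    have s: "(\<lambda>n. 2 / 3 ^ Suc n :: real) sums 1"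
      using sums_mult[OF geometric_sums[of "1/3::real"], of "2/3"] by (simp add: field_simps)
    have b: "2 * a p n / 3 ^ Suc n \<le> 2 / 3 ^ Suc n" "0 \<le> 2 * a p n / 3 ^ Suc n" for n by (auto simp: a_def)
    have sm: "summable (\<lambda>n. 2 * a p n / 3 ^ Suc n)"
      by (rule summable_comparison_test'[where N = 0 and g = "\<lambda>n. 2 / 3 ^ Suc n"])
        (use s in \<open>auto simp: sums_iff a_def\<close>)
    show ?thesis unfolding e_def
      using suminf_nonneg[OF sm b(2)] suminf_le[OF b(1) sm] s by (auto simp: sums_iff)
  qed
  define \<Gamma> where "\<Gamma> = closure ((\<lambda>q. (e q, q)) ` M)"
  have sub: "\<Gamma> \<subseteq> {0..1} \<times> M" unfolding \<Gamma>_def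
    by (rule closure_minimal) (use e01 in \<open>auto intro: closed_Times compact_imp_closed[OF M(1)]\<close>)
  have cG: "compact \<Gamma>"
    using compact_Int_closed[OF compact_Times[OF compact_Icc[of 0 "1::real"] M(1)], of \<Gamma>] sub
    by (simp add: \<Gamma>_def Int_absorb1)
  \<comment> \<open>Taking the closure adds limit points, but a code still determines its point: two
    points over one code are limits of points of \<open>M\<close> with nearby codes, and
    \<open>uc\<close> makes those points close.\<close>
  have inj: "inj_on fst \<Gamma>"
  proof (rule inj_onI, rule ccontr)
    fix u v assume u: "u \<in> \<Gamma>" and v: "v \<in> \<Gamma>" and eq: "fst u = fst v" and ne: "u \<noteq> v"
    define \<epsilon> where "\<epsilon> = dist (snd u) (snd v) / 3"
    have "\<epsilon> > 0" using eq ne by (auto simp: \<epsilon>_def prod_eq_iff)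
    from uc[OF this] obtain \<delta> where \<delta>: "\<delta> > 0" "\<And>p q. p \<in> M \<Longrightarrow> q \<in> M \<Longrightarrow> \<bar>e p - e q\<bar> < \<delta> \<Longrightarrow> dist p q < \<epsilon>"
      by blast
    have close: "\<exists>q\<in>M. dist (e q) (fst w) < \<delta> / 2 \<and> dist q (snd w) < \<epsilon>" if "w \<in> \<Gamma>" for w
    proof -
      have "min (\<delta> / 2) \<epsilon> > 0" using \<delta> \<open>\<epsilon> > 0\<close> by simp
      with that obtain q where "q \<in> M" "dist (e q, q) w < min (\<delta> / 2) \<epsilon>"
        unfolding \<Gamma>_def closure_approachable by blast
      then show ?thesis using dist_fst_le[of "(e q, q)" w] dist_snd_le[of "(e q, q)" w]
        by (intro bexI[of _ q]) auto
    qed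
    obtain p where p: "p \<in> M" "dist (e p) (fst u) < \<delta> / 2" "dist p (snd u) < \<epsilon>" using close[OF u] by auto
    obtain q where q: "q \<in> M" "dist (e q) (fst v) < \<delta> / 2" "dist q (snd v) < \<epsilon>" using close[OF v] by auto
    have "\<bar>e p - e q\<bar> < \<delta>" using p(2) q(2) eq unfolding dist_real_def by linarith
    then have "dist p q < \<epsilon>" using \<delta>(2) p q by blast
    then have "dist (snd u) (snd v) < 3 * \<epsilon>"
      using p q dist_triangle[of "snd u" "snd v" p] dist_triangle[of p "snd v" q]
      by (simp add: dist_commute)
    then show False by (simp add: \<epsilon>_def)
  qed
  show thesis
  proof (rule that)
    show "compact (fst ` \<Gamma>)" using cG by (intro compact_continuous_image continuous_intros)
    have "continuous_on (fst ` \<Gamma>) (the_inv_into \<Gamma> fst)"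
      by (rule continuous_on_inv_into[OF _ cG inj]) (intro continuous_intros)
    then show "continuous_on (fst ` \<Gamma>) (snd \<circ> the_inv_into \<Gamma> fst)"
      by (intro continuous_on_compose) (auto intro: continuous_intros)
    have "(snd \<circ> the_inv_into \<Gamma> fst) ` fst ` \<Gamma> = snd ` \<Gamma>"
      using the_inv_into_f_f[OF inj] by (force simp: image_iff)
    also have "\<dots> = M"
    proof
      show "snd ` \<Gamma> \<subseteq> M" using sub by auto
      show "M \<subseteq> snd ` \<Gamma>"
      proof
        fix q assume "q \<in> M"
        then have "(e q, q) \<in> \<Gamma>" unfolding \<Gamma>_def by (intro subsetD[OF closure_subset]) auto
        then show "q \<in> snd ` \<Gamma>" by force
      qed
    qed
    finally show "(snd \<circ> the_inv_into \<Gamma> fst) ` fst ` \<Gamma> = M" .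
  qed
qed

lemma set_integrable_continuous_on_compact:
  fixes h :: "'a::metric_space \<Rightarrow> real"
  assumes "finite_measure \<nu>" and sets: "sets \<nu> = sets borel"
    and M: "compact M" and h: "continuous_on M h"
  shows "set_integrable \<nu> M h"
proof -
  interpret finite_measure \<nu> by fact
  have "bounded (h ` M)" using compact_continuous_image[OF h M] by (rule compact_imp_bounded)
  then obtain B where B: "\<And>z. z \<in> M \<Longrightarrow> norm (h z) \<le> B" by (auto simp: bounded_iff)
  have "M \<in> sets borel" using M by (simp add: borel_closed compact_imp_closed)
  then have "(\<lambda>z. indicator M z *\<^sub>R h z) \<in> borel_measurable \<nu>"
    using borel_measurable_continuous_on_indicator[OF _ h] by (simp add: measurable_cong_sets[OF sets refl])
  then show ?thesis unfolding set_integrable_def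
    by (intro integrable_const_bound[where B = "max B 0"] AE_I2) (auto simp: indicator_def le_max_iff_disj dest: B)
qed

text \<open>Preimages under a continuous surjection from a compact set of reals turn the averages
  into integrals against tight distributions on the line. A weak limit of these is pushed forward to
  \<open>M\<close>. The subsequence is chosen before \<open>h\<close>, so it serves all test
  functions at once.\<close>

lemma empirical_measures_weak_limit:
  fixes M :: "'a::metric_space set" and p :: "nat \<Rightarrow> nat \<Rightarrow> 'a" and k :: "nat \<Rightarrow> nat"
  assumes M: "compact M" and p: "\<And>n j. p n j \<in> M" and k: "\<And>n. k n > 0"
  obtains r \<nu> where "strict_mono (r :: nat \<Rightarrow> nat)" "prob_space \<nu>" "sets \<nu> = sets borel" "emeasure \<nu> M = 1"
    "\<And>h :: 'a \<Rightarrow> real. continuous_on M h \<Longrightarrow>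
       (\<lambda>n. (\<Sum>j<k (r n). h (p (r n) j)) / real (k (r n))) \<longlonglongrightarrow> (LINT z:M|\<nu>. h z)"
proof -
  have "M \<noteq> {}" using p by blast
  with M obtain C :: "real set" and \<psi> where C: "compact C" "continuous_on C \<psi>" "\<psi> ` C = M"
    using compact_metric_image_of_real_compact by blast
  have "\<exists>s\<in>C. \<psi> s = p n j" for n j using p[of n j] C(3) by (auto simp: image_iff)
  then obtain c where c: "\<And>n j. c n j \<in> C" "\<And>n j. \<psi> (c n j) = p n j" by metis
  define \<mu> where "\<mu> n = distr (measure_pmf (pmf_of_set {..<k n})) borel (c n)" for n
  have \<mu>: "real_distribution (\<mu> n)" for n
    unfolding \<mu>_def by (rule prob_space.real_distribution_distr) (auto simp: measure_pmf.prob_space_axioms)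
  have int: "integral\<^sup>L (\<mu> n) f = (\<Sum>j<k n. f (c n j)) / real (k n)"
    if "f \<in> borel_measurable borel" for f :: "real \<Rightarrow> real" and n
    unfolding \<mu>_def using that k[of n]
    by (subst integral_distr) (auto simp: integral_pmf_of_set lessThan_empty_iff)
  have "tight \<mu>"
    unfolding tight_def
  proof (intro conjI allI impI)
    fix \<epsilon> :: real assume "\<epsilon> > 0"
    obtain B where B: "\<And>s. s \<in> C \<Longrightarrow> \<bar>s\<bar> \<le> B" using compact_imp_bounded[OF C(1)] by (auto simp: bounded_iff)
    have "0 \<le> B" using B[OF c(1)[of 0 0]] by linarith
    show "\<exists>a b. a < b \<and> (\<forall>n. 1 - \<epsilon> < measure (\<mu> n) {a<..b})"
    proof (intro exI conjI allI)
      \<comment> \<open>The interval is open on the left, so the extra 1 is what keeps the possible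
        value \<open>- B\<close> inside.\<close>
      show "- B - 1 < B" using \<open>0 \<le> B\<close> by simp
      fix n
      have "c n -` {- B - 1<..B} = UNIV" using B[OF c(1)[of n]] by (force simp: abs_le_iff)
      then have "measure (\<mu> n) {- B - 1<..B} = 1"
        unfolding \<mu>_def by (subst measure_distr) auto
      then show "1 - \<epsilon> < measure (\<mu> n) {- B - 1<..B}" using \<open>\<epsilon> > 0\<close> by simp
    qed
  qed (rule \<mu>)
  from tight_imp_convergent_subsubsequence[OF this strict_mono_id]
  obtain r m where r: "strict_mono (r :: nat \<Rightarrow> nat)" and m: "real_distribution m"
    and conv: "weak_conv_m (\<lambda>n. \<mu> (r n)) m" by (auto simp: comp_def)
  interpret m: real_distribution m by fact
  have lim: "(\<lambda>n. (\<Sum>j<k (r n). f (c (r n) j)) / real (k (r n))) \<longlonglongrightarrow> integral\<^sup>L m f"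
    if f: "continuous_on UNIV f" and B: "\<And>x. norm (f x) \<le> B" for f :: "real \<Rightarrow> real" and B
  proof -
    have "isCont f x" for x using f by (simp add: continuous_on_eq_continuous_at)
    from weak_conv_imp_integral_bdd_continuous_conv[OF \<mu> m conv this B]
    show ?thesis using f by (simp add: int borel_measurable_continuous_onI)
  qed
  \<comment> \<open>The truncated distance to \<open>C\<close> is a bounded continuous function
    vanishing on every sample point. Its integral against the limit is therefore zero, which forces
    the limit to be carried by the closed set \<open>C\<close>.\<close>
  have "integral\<^sup>L m (\<lambda>s. min 1 (infdist s C)) = 0"
  proof -
    have "(\<lambda>n. (\<Sum>j<k (r n). min 1 (infdist (c (r n) j) C)) / real (k (r n))) \<longlonglongrightarrow>
        integral\<^sup>L m (\<lambda>s. min 1 (infdist s C))"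
      by (rule lim[of _ 1]) (auto intro!: continuous_intros simp: infdist_nonneg)
    then have "(\<lambda>n. 0) \<longlonglongrightarrow> integral\<^sup>L m (\<lambda>s. min 1 (infdist s C))" using c(1) by simp
    then show ?thesis using LIMSEQ_unique tendsto_const by blast
  qed
  moreover have "(\<lambda>s. min 1 (infdist s C)) \<in> borel_measurable borel"
    by (intro borel_measurable_continuous_onI continuous_intros)
  then have "integrable m (\<lambda>s. min 1 (infdist s C))"
    by (intro m.integrable_const_bound[where B = 1]) (auto simp: infdist_nonneg)
  ultimately have "AE s in m. min 1 (infdist s C) = 0"
    by (subst (asm) integral_nonneg_eq_0_iff_AE) (auto simp: infdist_nonneg)
  then have AEC: "AE s in m. s \<in> C"
  proof eventually_elim
    case (elim s)
    then have "infdist s C = 0" by (auto simp: min_def split: if_splits)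
    moreover have "C \<noteq> {}" using c(1) by blast
    ultimately show ?case using C(1) in_closed_iff_infdist_zero compact_imp_closed by blast
  qed
  \<comment> \<open>The limit lives on the whole line, while \<open>\<psi>\<close> is controlled
    only on \<open>C\<close>. The default value \<open>p 0 0\<close> keeps \<open>\<Psi>\<close>
    measurable and inside \<open>M\<close> everywhere, and is met only on a null set.\<close>
  define \<Psi> where "\<Psi> s = (if s \<in> C then \<psi> s else p 0 0)" for s
  have \<Psi>M: "\<Psi> s \<in> M" for s using C(3) p by (auto simp: \<Psi>_def)
  have \<Psi>m [measurable]: "\<Psi> \<in> m \<rightarrow>\<^sub>M borel"
  proof -
    have "(\<lambda>s. if s \<in> C then \<psi> s else p 0 0) \<in> borel \<rightarrow>\<^sub>M borel"
      by (rule borel_measurable_continuous_on_if) (use C in \<open>auto simp: borel_closed compact_imp_closed\<close>)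
    then show ?thesis unfolding \<Psi>_def[abs_def] by simp
  qed
  define \<nu> where "\<nu> = distr m borel \<Psi>"
  have bM: "M \<in> sets borel" using M by (simp add: borel_closed compact_imp_closed)
  show thesis
  proof (rule that[OF r])
    show "prob_space \<nu>" unfolding \<nu>_def by (rule m.prob_space_distr) simp
    show "sets \<nu> = sets borel" by (simp add: \<nu>_def)
    have "\<Psi> -` M \<inter> space m = space m" using \<Psi>M by auto
    then show "emeasure \<nu> M = 1" unfolding \<nu>_def using bM m.emeasure_space_1
      by (subst emeasure_distr) auto
    fix h :: "'a \<Rightarrow> real" assume h: "continuous_on M h"
    have "continuous_on C (\<lambda>s. h (\<psi> s))"
      by (rule continuous_on_compose2[OF h C(2)]) (use C(3) in auto)
    moreover from compact_imp_bounded[OF compact_continuous_image[OF this C(1)]]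
    obtain B where B: "\<And>s. s \<in> C \<Longrightarrow> norm (h (\<psi> s)) \<le> B"
      unfolding bounded_iff by blast
    moreover have "0 \<le> B" using B[OF c(1)[of 0 0]] norm_ge_zero order_trans by blast
    \<comment> \<open>Weak convergence is tested by bounded continuous functions on the whole line,
      hence the Tietze extension with the same bound.\<close>
    ultimately obtain g where g: "continuous_on UNIV g" "\<And>s. s \<in> C \<Longrightarrow> g s = h (\<psi> s)" "\<And>s. norm (g s) \<le> B"
      using Tietze[of C "\<lambda>s. h (\<psi> s)" UNIV B] C(1) by (auto simp: compact_imp_closed)
    have "(LINT z:M|\<nu>. h z) = (LINT s|m. indicator M (\<Psi> s) *\<^sub>R h (\<Psi> s))"
      unfolding set_lebesgue_integral_def \<nu>_def
      by (rule integral_distr) (use borel_measurable_continuous_on_indicator[OF bM h] in auto)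
    also have "\<dots> = integral\<^sup>L m g"
    proof (rule integral_cong_AE)
      show "(\<lambda>s. indicator M (\<Psi> s) *\<^sub>R h (\<Psi> s)) \<in> borel_measurable m"
        using measurable_compose[OF \<Psi>m borel_measurable_continuous_on_indicator[OF bM h]] .
      show "g \<in> borel_measurable m" using g(1) by (simp add: borel_measurable_continuous_onI)
      show "AE s in m. indicator M (\<Psi> s) *\<^sub>R h (\<Psi> s) = g s"
        using AEC by eventually_elim (simp add: \<Psi>M g(2), simp add: \<Psi>_def)
    qed
    finally show "(\<lambda>n. (\<Sum>j<k (r n). h (p (r n) j)) / real (k (r n))) \<longlonglongrightarrow> (LINT z:M|\<nu>. h z)"
      using lim[OF g(1,3)] g(2) c by simp
  qed
qed

text \<open>A function is determined up to an error \<open>3 / (j + 1)\<close> by countable data: a net \<open>xs m\<close> on whose scale it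
  oscillates by less than \<open>1 / (j + 1)\<close>, and its values on the net, rounded to multiples of \<open>1 / (j + 1)\<close>.\<close>
lemma continuous_functions_countable_dense_subset:
  fixes M :: "'a::metric_space set" and W :: "('a \<Rightarrow> real) set"
  assumes M: "compact M" and W: "W \<noteq> {}" "\<And>f. f \<in> W \<Longrightarrow> continuous_on M f"
  shows "\<exists>w :: nat \<Rightarrow> 'a \<Rightarrow> real. (\<forall>i. w i \<in> W) \<and>
    (\<forall>f\<in>W. \<forall>\<epsilon>>0. \<exists>i. \<forall>z\<in>M. \<bar>f z - w i z\<bar> < \<epsilon>)"
proof -
  have "\<forall>m. \<exists>xs. set xs \<subseteq> M \<and> M \<subseteq> (\<Union>x\<in>set xs. ball x (1 / real (Suc m)))"
  proof
    fix m :: nat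
    have "0 < 1 / real (Suc m)" by simp
    then obtain T where "finite T" "T \<subseteq> M" "M \<subseteq> (\<Union>x\<in>T. ball x (1 / real (Suc m)))"
      using seq_compact_imp_totally_bounded[of M] M by (metis compact_imp_seq_compact)
    then show "\<exists>xs. set xs \<subseteq> M \<and> M \<subseteq> (\<Union>x\<in>set xs. ball x (1 / real (Suc m)))"
      using finite_list by metis
  qed
  then obtain xs where xs: "\<And>m. set (xs m) \<subseteq> M" "\<And>m. M \<subseteq> (\<Union>x\<in>set (xs m). ball x (1 / real (Suc m)))"
    by metis
  define sig where "sig m j f = map (\<lambda>x. \<lfloor>f x * real (Suc j)\<rfloor>) (xs m)" for m j :: nat and f :: "'a \<Rightarrow> real"
  define P where "P m j f \<longleftrightarrow> (\<forall>x\<in>M. \<forall>y\<in>M. dist x y < 1 / real (Suc m) \<longrightarrow> \<bar>f x - f y\<bar> < 1 / real (Suc j))"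
    for m j :: nat and f :: "'a \<Rightarrow> real"
  define R where "R t f \<longleftrightarrow> f \<in> W \<and> (case t of (m, j, l) \<Rightarrow> P m j f \<and> sig m j f = l)"
    for t :: "nat \<times> nat \<times> int list" and f
  \<comment> \<open>One representative from \<open>W\<close> is kept for every code that some member
    of \<open>W\<close> realises. Other indices get an arbitrary member, so that the sequence never
    leaves \<open>W\<close>.\<close>
  define w where "w i = (if \<exists>f. R (from_nat i) f then SOME f. R (from_nat i) f else SOME f. f \<in> W)" for i :: nat
  have wR: "R (from_nat i) (w i)" if "R (from_nat i) f" for i f
    using that someI[of "R (from_nat i)" f] by (auto simp: w_def)
  show ?thesis
  proof (intro exI[of _ w] conjI ballI allI impI)
    fix i show "w i \<in> W"
    proof (cases "\<exists>f. R (from_nat i) f")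
      case True then show ?thesis using wR by (auto simp: R_def)
    next
      case False then show ?thesis using W(1) by (auto simp: w_def some_in_eq)
    qed
  next
    fix f and \<epsilon> :: real assume f: "f \<in> W" and \<epsilon>: "\<epsilon> > 0"
    obtain j where j: "1 / real (Suc j) < \<epsilon> / 3"
      using reals_Archimedean[of "\<epsilon> / 3"] \<epsilon> by (auto simp: inverse_eq_divide)
    have "uniformly_continuous_on M f" using W(2)[OF f] M by (rule compact_uniformly_continuous)
    moreover have "0 < 1 / real (Suc j)" by simp
    ultimately obtain \<delta> where \<delta>: "\<delta> > 0" "\<And>x y. x \<in> M \<Longrightarrow> y \<in> M \<Longrightarrow> dist y x < \<delta> \<Longrightarrow> dist (f y) (f x) < 1 / real (Suc j)"
      unfolding uniformly_continuous_on_def by metis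
    obtain m where m: "1 / real (Suc m) < \<delta>"
      using reals_Archimedean[of \<delta>] \<delta>(1) by (auto simp: inverse_eq_divide)
    have Pf: "P m j f" unfolding P_def using \<delta>(2) m by (force simp: dist_real_def)
    define i where "i = to_nat (m, j, sig m j f)"
    have "R (from_nat i) f" using f Pf by (simp add: R_def i_def)
    from wR[OF this] have Pw: "P m j (w i)" and sw: "sig m j (w i) = sig m j f" by (auto simp: R_def i_def)
    have "\<bar>f z - w i z\<bar> < \<epsilon>" if z: "z \<in> M" for z
    proof -
      obtain x where x: "x \<in> set (xs m)" "dist x z < 1 / real (Suc m)" using xs(2)[of m] z by auto
      have "x \<in> M" using x xs(1) by blast
      have "\<bar>f x - f z\<bar> < 1 / real (Suc j)" "\<bar>w i x - w i z\<bar> < 1 / real (Suc j)"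
        using Pf Pw x z \<open>x \<in> M\<close> unfolding P_def by auto
      moreover have "\<lfloor>w i x * real (Suc j)\<rfloor> = \<lfloor>f x * real (Suc j)\<rfloor>"
        using sw x(1) unfolding sig_def by (simp add: map_eq_conv)
      then have "\<bar>w i x * real (Suc j) - f x * real (Suc j)\<bar> < 1" by linarith
      then have "\<bar>w i x - f x\<bar> * real (Suc j) < 1"
        by (simp add: abs_mult left_diff_distrib[symmetric] del: of_nat_Suc)
      then have "\<bar>w i x - f x\<bar> < 1 / real (Suc j)" by (simp add: field_simps)
      ultimately show ?thesis using j by linarith
    qed
    then show "\<exists>i. \<forall>z\<in>M. \<bar>f z - w i z\<bar> < \<epsilon>" by blast
  qed
qed

text \<open>Blackwell's approachability argument: the next point is chosen so that its payoff vector makes an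
  obtuse angle with the current sum, which keeps the squared length of the sum growing only linearly.\<close>
lemma approachability_point_sequence:
  fixes w :: "nat \<Rightarrow> 'a \<Rightarrow> real"
  assumes bound: "\<And>i z. i < n \<Longrightarrow> z \<in> M \<Longrightarrow> \<bar>w i z\<bar> \<le> B"
    and nonneg: "\<And>l. \<exists>z\<in>M. 0 \<le> (\<Sum>i<n. l i * w i z)"
  shows "\<exists>p. (\<forall>j. p j \<in> M) \<and> (\<forall>k. (\<Sum>i<n. (\<Sum>j<k. w i (p j))\<^sup>2) \<le> real k * (real n * B\<^sup>2))"
proof -
  \<comment> \<open>Such a point exists by \<open>nonneg\<close> for the reversed coefficients
    \<open>- s\<close>.\<close>
  define pick where "pick s = (SOME z. z \<in> M \<and> (\<Sum>i<n. s i * w i z) \<le> 0)" for s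
  have pick: "pick s \<in> M" "(\<Sum>i<n. s i * w i (pick s)) \<le> 0" for s
  proof -
    have "\<exists>z. z \<in> M \<and> (\<Sum>i<n. s i * w i z) \<le> 0"
      using nonneg[of "\<lambda>i. - s i"] by (auto simp: sum_negf)
    from someI_ex[OF this] show "pick s \<in> M" "(\<Sum>i<n. s i * w i (pick s)) \<le> 0" by (auto simp: pick_def)
  qed
  define S :: "nat \<Rightarrow> nat \<Rightarrow> real" where "S = rec_nat (\<lambda>_. 0) (\<lambda>k s i. s i + w i (pick s))"
  have S: "S 0 i = 0" "S (Suc k) i = S k i + w i (pick (S k))" for i k by (simp_all add: S_def)
  have Ssum: "S k i = (\<Sum>j<k. w i (pick (S j)))" for k i by (induction k) (simp_all add: S)
  have bd: "(\<Sum>i<n. (S k i)\<^sup>2) \<le> real k * (real n * B\<^sup>2)" for k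
  proof (induction k)
    case (Suc k)
    have "(\<Sum>i<n. (w i (pick (S k)))\<^sup>2) \<le> (\<Sum>i<n. B\<^sup>2)"
    proof (rule sum_mono)
      fix i assume "i \<in> {..<n}"
      then have "\<bar>w i (pick (S k))\<bar> \<le> B" using bound pick(1) by auto
      then show "(w i (pick (S k)))\<^sup>2 \<le> B\<^sup>2" using power_mono[of "\<bar>w i (pick (S k))\<bar>" B 2] by simp
    qed
    moreover have "(\<Sum>i<n. (S (Suc k) i)\<^sup>2) =
        (\<Sum>i<n. (S k i)\<^sup>2) + 2 * (\<Sum>i<n. S k i * w i (pick (S k))) + (\<Sum>i<n. (w i (pick (S k)))\<^sup>2)"
      by (simp add: S power2_sum sum.distrib sum_distrib_left mult.assoc)
    ultimately show ?case using Suc pick(2)[of "S k"] by (simp add: algebra_simps)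
  qed (simp add: S)
  show ?thesis
  proof (intro exI conjI allI)
    show "pick (S j) \<in> M" for j by (rule pick)
    show "(\<Sum>i<n. (\<Sum>j<k. w i (pick (S j)))\<^sup>2) \<le> real k * (real n * B\<^sup>2)" for k
      using bd[of k] by (simp only: Ssum[of k])
  qed
qed

text \<open>Approachability gives, for each \<open>n\<close>, an empirical measure on which the
  first \<open>n\<close> members of a countable dense family average to at most
  \<open>1 / real (Suc n)\<close> in absolute value. A weak limit annihilates the whole family, and
  density extends this to \<open>W\<close>.\<close>

theorem annihilating_probability_exists:
  fixes M :: "'a::metric_space set" and W :: "('a \<Rightarrow> real) set"
  assumes M: "compact M" and W: "W \<noteq> {}" "\<And>f. f \<in> W \<Longrightarrow> continuous_on M f"
    and add: "\<And>f g. f \<in> W \<Longrightarrow> g \<in> W \<Longrightarrow> (\<lambda>z. f z + g z) \<in> W"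
    and scale: "\<And>f l. f \<in> W \<Longrightarrow> (\<lambda>z. l * f z) \<in> W"
    and nonneg: "\<And>f. f \<in> W \<Longrightarrow> \<exists>z\<in>M. 0 \<le> f z"
  obtains \<nu> where "prob_space \<nu>" "sets \<nu> = sets borel" "emeasure \<nu> M = 1" "\<And>f. f \<in> W \<Longrightarrow> (LINT z:M|\<nu>. f z) = 0"
proof -
  have "\<exists>w :: nat \<Rightarrow> 'a \<Rightarrow> real. (\<forall>i. w i \<in> W) \<and> (\<forall>f\<in>W. \<forall>\<epsilon>>0. \<exists>i. \<forall>z\<in>M. \<bar>f z - w i z\<bar> < \<epsilon>)"
    by (rule continuous_functions_countable_dense_subset) (use M W in auto)
  then obtain w :: "nat \<Rightarrow> 'a \<Rightarrow> real" where w': "(\<forall>i. w i \<in> W) \<and> (\<forall>f\<in>W. \<forall>\<epsilon>>0. \<exists>i. \<forall>z\<in>M. \<bar>f z - w i z\<bar> < \<epsilon>)" ..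
  then have w: "w i \<in> W" for i by simp
  from w' have dense: "\<exists>i. \<forall>z\<in>M. \<bar>f z - w i z\<bar> < \<epsilon>" if "f \<in> W" "\<epsilon> > 0" for f \<epsilon> using that by simp
  have zero: "(\<lambda>z. 0) \<in> W" using w[of 0] scale[of "w 0" 0] by simp
  have comb: "(\<lambda>z. \<Sum>i<n. l i * w i z) \<in> W" for n l
    by (induction n) (simp_all add: zero add scale w)
  have "\<exists>p k. (\<forall>j. p j \<in> M) \<and> 0 < (k::nat) \<and> (\<forall>i<n. \<bar>(\<Sum>j<k. w i (p j)) / real k\<bar> \<le> 1 / real (Suc n))" for n
  proof -
    have "\<exists>B. \<forall>z\<in>M. \<bar>w i z\<bar> \<le> B" for i
      using compact_imp_bounded[OF compact_continuous_image[OF W(2)[OF w] M], of i] by (auto simp: bounded_iff)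
    then obtain b where b: "\<And>i z. z \<in> M \<Longrightarrow> \<bar>w i z\<bar> \<le> b i" by metis
    define B where "B = (\<Sum>i<n. \<bar>b i\<bar>)"
    have B: "\<bar>w i z\<bar> \<le> B" if "i < n" "z \<in> M" for i z
    proof -
      have "\<bar>w i z\<bar> \<le> \<bar>b i\<bar>" using b[OF that(2), of i] by linarith
      also have "\<dots> \<le> B" unfolding B_def using that(1) by (intro member_le_sum) auto
      finally show ?thesis .
    qed
    have "\<exists>p. (\<forall>j. p j \<in> M) \<and> (\<forall>k. (\<Sum>i<n. (\<Sum>j<k. w i (p j))\<^sup>2) \<le> real k * (real n * B\<^sup>2))"
      by (rule approachability_point_sequence) (use B nonneg[OF comb] in auto)
    then obtain p where p': "(\<forall>j. p j \<in> M) \<and> (\<forall>k. (\<Sum>i<n. (\<Sum>j<k. w i (p j))\<^sup>2) \<le> real k * (real n * B\<^sup>2))" ..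
    then have p: "p j \<in> M" "(\<Sum>i<n. (\<Sum>j<k. w i (p j))\<^sup>2) \<le> real k * (real n * B\<^sup>2)" for j k
      by simp_all
    \<comment> \<open>The sums grow only like the square root of
      \<open>real k * (real n * B\<^sup>2)\<close>, so this many points bring every average below
      \<open>1 / real (Suc n)\<close>. The maximum with 0 secures a positive number of
      points.\<close>
    obtain k :: nat where k: "max 0 (real n * B\<^sup>2 * (real (Suc n))\<^sup>2) < real k"
      using reals_Archimedean2 by blast
    then have "0 < real k" by (rule le_less_trans[OF max.cobounded1])
    then have "k > 0" by simp
    have "\<bar>(\<Sum>j<k. w i (p j)) / real k\<bar> \<le> 1 / real (Suc n)" if "i < n" for i
    proof -
      define s where "s = (\<Sum>j<k. w i (p j))"
      have "s\<^sup>2 \<le> (\<Sum>i<n. (\<Sum>j<k. w i (p j))\<^sup>2)"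
        unfolding s_def using that by (intro member_le_sum[of i _ "\<lambda>i. (\<Sum>j<k. w i (p j))\<^sup>2"]) auto
      also have "\<dots> \<le> real k * (real n * B\<^sup>2)" by (rule p)
      finally have "s\<^sup>2 * (real (Suc n))\<^sup>2 \<le> real k * (real n * B\<^sup>2) * (real (Suc n))\<^sup>2"
        by (rule mult_right_mono) simp
      also have "\<dots> = real k * (real n * B\<^sup>2 * (real (Suc n))\<^sup>2)" by (simp add: mult_ac)
      also have "\<dots> \<le> real k * real k" using k by (intro mult_left_mono) auto
      finally have "(\<bar>s\<bar> * real (Suc n))\<^sup>2 \<le> (real k)\<^sup>2" by (simp only: power_mult_distrib power2_abs power2_eq_square[of "real k"])
      then have "\<bar>s\<bar> * real (Suc n) \<le> real k" by (rule power2_le_imp_le) simp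
      then show ?thesis using \<open>k > 0\<close> by (simp add: s_def[symmetric] abs_divide field_simps)
    qed
    with p(1) \<open>k > 0\<close> show ?thesis by blast
  qed
  then obtain p k where p: "\<And>n j. p n j \<in> M" and k: "\<And>n. 0 < (k n :: nat)"
    and avg: "\<And>n i. i < n \<Longrightarrow> \<bar>(\<Sum>j<k n. w i (p n j)) / real (k n)\<bar> \<le> 1 / real (Suc n)"
    by metis
  obtain r \<nu> where r: "strict_mono (r :: nat \<Rightarrow> nat)" and \<nu>: "prob_space \<nu>" "sets \<nu> = sets borel" "emeasure \<nu> M = 1"
    and lim: "\<And>h :: 'a \<Rightarrow> real. continuous_on M h \<Longrightarrow>
       (\<lambda>n. (\<Sum>j<k (r n). h (p (r n) j)) / real (k (r n))) \<longlonglongrightarrow> (LINT z:M|\<nu>. h z)"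
    using empirical_measures_weak_limit[of M p k, OF M p k] by blast
  interpret prob_space \<nu> by fact
  have w0: "(LINT z:M|\<nu>. w i z) = 0" for i
  proof -
    have "(\<lambda>n. (\<Sum>j<k n. w i (p n j)) / real (k n)) \<longlonglongrightarrow> 0"
    proof (rule Lim_null_comparison)
      show "\<forall>\<^sub>F n in sequentially. norm ((\<Sum>j<k n. w i (p n j)) / real (k n)) \<le> 1 / real (Suc n)"
        using eventually_gt_at_top[of i] by eventually_elim (use avg in auto)
      show "(\<lambda>n. 1 / real (Suc n)) \<longlonglongrightarrow> 0" using LIMSEQ_inverse_real_of_nat by (simp add: inverse_eq_divide)
    qed
    from LIMSEQ_subseq_LIMSEQ[OF this r] lim[OF W(2)[OF w[of i]]]
    show ?thesis using LIMSEQ_unique by (auto simp: comp_def)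
  qed
  have "(LINT z:M|\<nu>. f z) = 0" if f: "f \<in> W" for f
  proof (rule ccontr)
    assume "(LINT z:M|\<nu>. f z) \<noteq> 0"
    \<comment> \<open>Precision half of the supposed integral suffices: \<open>w i\<close>
      integrates to zero and \<open>\<nu>\<close> has mass one, so the integral would be at most
      half of itself in absolute value.\<close>
    then obtain i where i: "\<And>z. z \<in> M \<Longrightarrow> \<bar>f z - w i z\<bar> < \<bar>LINT z:M|\<nu>. f z\<bar> / 2"
      using dense[OF f, of "\<bar>LINT z:M|\<nu>. f z\<bar> / 2"] by auto
    have I: "set_integrable \<nu> M g" if "g \<in> W" for g
      using set_integrable_continuous_on_compact[OF finite_measure_axioms \<nu>(2) M W(2)[OF that]] .
    have "(LINT z:M|\<nu>. f z) = (LINT z:M|\<nu>. f z - w i z)"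
      using w0[of i] I[OF f] I[OF w] by (simp add: set_integral_diff)
    also have "norm \<dots> \<le> (LINT z|\<nu>. norm (indicator M z *\<^sub>R (f z - w i z)))"
      unfolding set_lebesgue_integral_def by (rule integral_norm_bound)
    also have "\<dots> \<le> (LINT z|\<nu>. \<bar>LINT z:M|\<nu>. f z\<bar> / 2)"
    proof (rule integral_mono)
      show "integrable \<nu> (\<lambda>z. norm (indicator M z *\<^sub>R (f z - w i z)))"
        using set_integral_diff(1)[OF I[OF f] I[OF w[of i]]] by (intro integrable_norm) (simp add: set_integrable_def)
      show "norm (indicator M z *\<^sub>R (f z - w i z)) \<le> \<bar>LINT z:M|\<nu>. f z\<bar> / 2" for z
        using i[of z] by (auto simp: indicator_def)
    qed simp
    finally show False using \<open>(LINT z:M|\<nu>. f z) \<noteq> 0\<close> by (simp add: prob_space)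
  qed
  with \<nu> show thesis by (rule that)
qed

section \<open>Extrema under the conormal boundary condition\<close>

lemma continuous_on_mat_vec_mult:
  fixes A :: "'a::topological_space \<Rightarrow> real^'n^'m"
  assumes "continuous_on S A" "continuous_on S v"
  shows "continuous_on S (\<lambda>x. A x *v v x)"
  unfolding matrix_vector_mult_def using assms by (intro continuous_intros continuous_on_vec_lambda)

lemma increasing_from_endpoint:
  fixes f f' :: "real \<Rightarrow> real"
  assumes der: "\<And>t. 0 < t \<Longrightarrow> t < \<delta> \<Longrightarrow> (f has_real_derivative f' t) (at t)"
    and lim: "(f \<longlongrightarrow> f 0) (at_right 0)"
    and pos: "\<And>t. 0 < t \<Longrightarrow> t < \<delta> \<Longrightarrow> 0 < f' t"
    and t: "0 < t" "t < \<delta>"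
  shows "f 0 < f t"
proof (rule DERIV_pos_imp_increasing_open[OF t(1)])
  show "\<exists>y. DERIV f x :> y \<and> y > 0" if "0 < x" "x < t" for x
    using der[of x] pos[of x] that t by auto
  have cont: "isCont f x" if "0 < x" "x \<le> t" for x
    using der[of x] that t DERIV_isCont by auto
  show "continuous_on {0..t} f"
  proof (rule continuous_on_IccI[OF lim _ _ t(1)])
    show "(f \<longlongrightarrow> f t) (at_left t)"
      using cont[of t] t(1) unfolding isCont_def by (auto intro: tendsto_within_subset)
    show "(f \<longlongrightarrow> f x) (at x)" if "0 < x" "x < t" for x
      using cont[of x] that by (simp add: isCont_def)
  qed
qed

text \<open>At 0 the values \<open>g' 0\<close> and \<open>g'' 0\<close> are only one-sided limits,
  as is the case when a segment starts on the boundary of the domain. A positive limit would keep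
  \<open>g'\<close> positive near 0, directly or after integrating \<open>g''\<close> once, and
  \<open>g\<close> would rise above \<open>g 0\<close>.\<close>

lemma endpoint_max_derivatives:
  fixes g g' g'' :: "real \<Rightarrow> real"
  assumes \<delta>: "0 < \<delta>"
    and der: "\<And>t. 0 < t \<Longrightarrow> t < \<delta> \<Longrightarrow> (g has_real_derivative g' t) (at t)"
    and der2: "\<And>t. 0 < t \<Longrightarrow> t < \<delta> \<Longrightarrow> (g' has_real_derivative g'' t) (at t)"
    and lim: "(g \<longlongrightarrow> g 0) (at_right 0)" "(g' \<longlongrightarrow> g' 0) (at_right 0)" "(g'' \<longlongrightarrow> g'' 0) (at_right 0)"
    and max: "\<And>t. 0 < t \<Longrightarrow> t < \<delta> \<Longrightarrow> g t \<le> g 0"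
  shows "g' 0 \<le> 0" and "g' 0 = 0 \<Longrightarrow> g'' 0 \<le> 0"
proof -
  have near: "\<exists>\<eta>>0. \<eta> \<le> \<delta> \<and> (\<forall>t. 0 < t \<longrightarrow> t < \<eta> \<longrightarrow> 0 < f t)"
    if "(f \<longlongrightarrow> f 0) (at_right 0)" "0 < f 0" for f :: "real \<Rightarrow> real"
  proof -
    have "\<forall>\<^sub>F t in at_right 0. 0 < f t" using that by (rule order_tendstoD)
    then obtain b where "b > 0" "\<And>t. 0 < t \<Longrightarrow> t < b \<Longrightarrow> 0 < f t" by (auto simp: eventually_at_right_field)
    then show ?thesis using \<delta> by (intro exI[of _ "min b \<delta>"]) auto
  qed
  have contr: False if "\<eta> > 0" "\<eta> \<le> \<delta>" and pos: "\<And>t. 0 < t \<Longrightarrow> t < \<eta> \<Longrightarrow> 0 < g' t" for \<eta>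
  proof -
    have "g 0 < g (\<eta> / 2)"
      by (rule increasing_from_endpoint[where f' = g' and \<delta> = \<eta>]) (use der lim pos that in auto)
    then show False using max[of "\<eta> / 2"] that by simp
  qed
  show "g' 0 \<le> 0"
  proof (rule ccontr)
    assume "\<not> g' 0 \<le> 0"
    then show False using near[OF lim(2)] contr by auto
  qed
  assume g0: "g' 0 = 0"
  show "g'' 0 \<le> 0"
  proof (rule ccontr)
    assume "\<not> g'' 0 \<le> 0"
    then obtain \<eta> where \<eta>: "\<eta> > 0" "\<eta> \<le> \<delta>" "\<And>t. 0 < t \<Longrightarrow> t < \<eta> \<Longrightarrow> 0 < g'' t" using near[OF lim(3)] by auto
    have "0 < g' t" if "0 < t" "t < \<eta>" for t
      using increasing_from_endpoint[of \<eta> g' g'' t] der2 lim(2) \<eta> that g0 by auto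
    then show False using contr \<eta> by blast
  qed
qed

text \<open>The unsimplified \<open>p + 0 *\<^sub>R h\<close> makes the limit literally the value at
  0 of the function of \<open>t\<close>, the form that \<open>endpoint_max_derivatives\<close> asks
  for.\<close>

lemma tendsto_at_right_along_segment:
  fixes f :: "'a::real_normed_vector \<Rightarrow> 'b::topological_space"
  assumes f: "continuous_on S f" and p: "p \<in> S" and \<delta>: "0 < \<delta>"
    and seg: "\<And>t. 0 < t \<Longrightarrow> t < \<delta> \<Longrightarrow> p + t *\<^sub>R h \<in> S"
  shows "((\<lambda>t. f (p + t *\<^sub>R h)) \<longlongrightarrow> f (p + 0 *\<^sub>R h)) (at_right 0)"
proof -
  have "((\<lambda>t. p + t *\<^sub>R h) \<longlongrightarrow> p + 0 *\<^sub>R h) (at_right 0)" by (intro tendsto_intros)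
  moreover have "\<forall>\<^sub>F t in at_right 0. p + t *\<^sub>R h \<in> S"
    unfolding eventually_at_right_field using \<delta> seg by blast
  ultimately show ?thesis
    by (intro continuous_on_tendsto_compose[OF f, of "\<lambda>t. p + t *\<^sub>R h"]) (use p in auto)
qed

lemma open_segment_start:
  fixes p h :: "'a::real_normed_vector"
  assumes "open U" "p \<in> U"
  obtains \<delta> where "0 < \<delta>" "\<And>t. 0 < t \<Longrightarrow> t < \<delta> \<Longrightarrow> p + t *\<^sub>R h \<in> U"
proof -
  obtain s where s: "s > 0" "ball p s \<subseteq> U" using assms open_contains_ball by blast
  have "p + t *\<^sub>R h \<in> U" if "0 < t" "t < s / (norm h + 1)" for t
  proof -
    have "t * norm h \<le> t * (norm h + 1)" using that by simp
    also have "\<dots> < s" using that by (simp add: field_simps add_pos_nonneg)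
    finally show ?thesis using s(2) that by (auto simp: dist_norm subset_eq)
  qed
  then show thesis using s(1) by (intro that[of "s / (norm h + 1)"]) (auto simp: add_nonneg_pos)
qed

lemma C2_closure_along_segment:
  assumes w: "C2_closure Q w Dw D2w" and p: "p \<in> closure Q" and \<delta>: "0 < \<delta>"
    and seg: "\<And>t. 0 < t \<Longrightarrow> t < \<delta> \<Longrightarrow> p + t *\<^sub>R h \<in> Q"
  shows "\<And>t. 0 < t \<Longrightarrow> t < \<delta> \<Longrightarrow>
      ((\<lambda>t. w (p + t *\<^sub>R h)) has_real_derivative Dw (p + t *\<^sub>R h) \<bullet> h) (at t)"
    and "\<And>t. 0 < t \<Longrightarrow> t < \<delta> \<Longrightarrow>
      ((\<lambda>t. Dw (p + t *\<^sub>R h) \<bullet> h) has_real_derivative (D2w (p + t *\<^sub>R h) *v h) \<bullet> h) (at t)"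
    and "((\<lambda>t. w (p + t *\<^sub>R h)) \<longlongrightarrow> w (p + 0 *\<^sub>R h)) (at_right 0)"
    and "((\<lambda>t. Dw (p + t *\<^sub>R h) \<bullet> h) \<longlongrightarrow> Dw (p + 0 *\<^sub>R h) \<bullet> h) (at_right 0)"
    and "((\<lambda>t. (D2w (p + t *\<^sub>R h) *v h) \<bullet> h) \<longlongrightarrow> (D2w (p + 0 *\<^sub>R h) *v h) \<bullet> h) (at_right 0)"
proof -
  have seg': "p + t *\<^sub>R h \<in> closure Q" if "0 < t" "t < \<delta>" for t
    using seg[OF that] closure_subset by blast
  note tends = tendsto_at_right_along_segment[OF _ p \<delta> seg']
  have cont: "continuous_on (closure Q) w" "continuous_on (closure Q) Dw" "continuous_on (closure Q) D2w"
    using w by (auto simp: C2_closure_def)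
  show "((\<lambda>t. w (p + t *\<^sub>R h)) \<longlongrightarrow> w (p + 0 *\<^sub>R h)) (at_right 0)"
    by (rule tends[OF cont(1)])
  show "((\<lambda>t. Dw (p + t *\<^sub>R h) \<bullet> h) \<longlongrightarrow> Dw (p + 0 *\<^sub>R h) \<bullet> h) (at_right 0)"
    by (intro tendsto_inner tendsto_const tends[OF cont(2)])
  show "((\<lambda>t. (D2w (p + t *\<^sub>R h) *v h) \<bullet> h) \<longlongrightarrow> (D2w (p + 0 *\<^sub>R h) *v h) \<bullet> h) (at_right 0)"
    by (rule tendsto_at_right_along_segment[OF _ p \<delta> seg', of "\<lambda>x. (D2w x *v h) \<bullet> h"])
      (intro continuous_intros continuous_on_mat_vec_mult cont)
  fix t :: real assume t: "0 < t" "t < \<delta>"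
  have line: "((\<lambda>t. p + t *\<^sub>R h) has_derivative (\<lambda>s. s *\<^sub>R h)) (at t)"
    by (auto intro!: derivative_eq_intros)
  have "(w has_derivative (\<lambda>u. Dw (p + t *\<^sub>R h) \<bullet> u)) (at (p + t *\<^sub>R h))"
    using w seg[OF t] by (auto simp: C2_closure_def)
  from has_derivative_compose[OF line this]
  show "((\<lambda>t. w (p + t *\<^sub>R h)) has_real_derivative Dw (p + t *\<^sub>R h) \<bullet> h) (at t)"
    by (simp add: has_field_derivative_def mult_commute_abs)
  have "(Dw has_derivative (\<lambda>u. D2w (p + t *\<^sub>R h) *v u)) (at (p + t *\<^sub>R h))"
    using w seg[OF t] by (auto simp: C2_closure_def)
  from has_derivative_inner_left[OF has_derivative_compose[OF line this], of h]
  show "((\<lambda>t. Dw (p + t *\<^sub>R h) \<bullet> h) has_real_derivative (D2w (p + t *\<^sub>R h) *v h) \<bullet> h) (at t)"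
    by (simp add: has_field_derivative_def mult_commute_abs matrix_vector_mult_scaleR)
qed

lemma directional_max:
  assumes w: "C2_closure Q w Dw D2w" and p: "p \<in> closure Q" and \<delta>: "0 < \<delta>"
    and seg: "\<And>t. 0 < t \<Longrightarrow> t < \<delta> \<Longrightarrow> p + t *\<^sub>R h \<in> Q"
    and max: "\<And>x. x \<in> Q \<Longrightarrow> w x \<le> w p"
  shows "Dw p \<bullet> h \<le> 0" and "Dw p \<bullet> h = 0 \<Longrightarrow> (D2w p *v h) \<bullet> h \<le> 0"
proof -
  note facts = C2_closure_along_segment[OF w p \<delta> seg]
  have max': "w (p + t *\<^sub>R h) \<le> w (p + 0 *\<^sub>R h)" if "0 < t" "t < \<delta>" for t
    using max[OF seg[OF that]] by simp
  have "Dw (p + 0 *\<^sub>R h) \<bullet> h \<le> 0"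
    by (rule endpoint_max_derivatives(1)[where g = "\<lambda>t. w (p + t *\<^sub>R h)" and g' = "\<lambda>t. Dw (p + t *\<^sub>R h) \<bullet> h"
          and g'' = "\<lambda>t. (D2w (p + t *\<^sub>R h) *v h) \<bullet> h" and \<delta> = \<delta>]) (rule \<delta> facts max' | assumption)+
  then show "Dw p \<bullet> h \<le> 0" by simp
  have "Dw (p + 0 *\<^sub>R h) \<bullet> h = 0 \<Longrightarrow> (D2w (p + 0 *\<^sub>R h) *v h) \<bullet> h \<le> 0"
    by (rule endpoint_max_derivatives(2)[where g = "\<lambda>t. w (p + t *\<^sub>R h)" and g' = "\<lambda>t. Dw (p + t *\<^sub>R h) \<bullet> h"
          and g'' = "\<lambda>t. (D2w (p + t *\<^sub>R h) *v h) \<bullet> h" and \<delta> = \<delta>]) (rule \<delta> facts max' | assumption)+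
  then show "Dw p \<bullet> h = 0 \<Longrightarrow> (D2w p *v h) \<bullet> h \<le> 0" by simp
qed

text \<open>Writes the second-order term as a sum of Hessian quadratic forms along the columns of
  \<open>\<sigma>\<close>, so that second derivatives along single lines control it.\<close>

lemma trace_diffmat_mult:
  "trace (diffmat \<sigma> x ** A) = (\<Sum>i\<in>UNIV. (A *v column i (\<sigma> x)) \<bullet> column i (\<sigma> x))"
proof -
  have "trace (diffmat \<sigma> x ** A) = (\<Sum>k\<in>UNIV. \<Sum>l\<in>UNIV. \<Sum>i\<in>UNIV. \<sigma> x $ k $ i * \<sigma> x $ l $ i * A $ l $ k)"
    by (simp add: trace_def diffmat_def matrix_matrix_mult_def transpose_def sum_distrib_right)
  also have "\<dots> = (\<Sum>k\<in>UNIV. \<Sum>i\<in>UNIV. \<Sum>l\<in>UNIV. \<sigma> x $ k $ i * \<sigma> x $ l $ i * A $ l $ k)"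
    by (intro sum.cong refl sum.swap)
  also have "\<dots> = (\<Sum>i\<in>UNIV. \<Sum>k\<in>UNIV. \<Sum>l\<in>UNIV. \<sigma> x $ k $ i * \<sigma> x $ l $ i * A $ l $ k)"
    by (rule sum.swap)
  also have "\<dots> = (\<Sum>i\<in>UNIV. \<Sum>l\<in>UNIV. \<Sum>k\<in>UNIV. \<sigma> x $ k $ i * \<sigma> x $ l $ i * A $ l $ k)"
    by (intro sum.cong refl sum.swap)
  also have "\<dots> = (\<Sum>i\<in>UNIV. (A *v column i (\<sigma> x)) \<bullet> column i (\<sigma> x))"
    by (simp add: inner_vec_def matrix_vector_mult_def column_def sum_distrib_right sum_distrib_left mult_ac)
  finally show ?thesis .
qed

lemma inner_diffmat: "u \<bullet> (diffmat \<sigma> x *v v) = (transpose (\<sigma> x) *v u) \<bullet> (transpose (\<sigma> x) *v v)"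
  by (simp add: diffmat_def matrix_vector_mul_assoc[symmetric] transpose_matrix_vector dot_lmul_matrix)

lemma norm_transpose_mult_eq_sum:
  "(norm (transpose A *v v))\<^sup>2 = (\<Sum>i\<in>UNIV. (column i A \<bullet> v)\<^sup>2)" for A :: "real^'n^'m"
  unfolding power2_norm_eq_inner
  by (simp add: inner_vec_def matrix_vector_mult_def transpose_def column_def power2_eq_square)

text \<open>The quadratic form attains its minimum \<open>e\<close> over the unit sphere. By
  symmetry of \<open>diffmat\<close>, vanishing of the first variation makes the minimiser an
  eigenvector with eigenvalue \<open>e\<close>, to which the bound on eigenvalues applies.\<close>

lemma diffmat_quadratic_lower_bound:
  fixes \<sigma> :: "real^'n \<Rightarrow> real^'n^'n"
  assumes eig: "\<And>e v. v \<noteq> 0 \<Longrightarrow> diffmat \<sigma> x *v v = e *\<^sub>R v \<Longrightarrow> m \<le> e"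
  shows "m * (norm u)\<^sup>2 \<le> u \<bullet> (diffmat \<sigma> x *v u)"
proof -
  let ?a = "diffmat \<sigma> x"
  define S where "S = sphere (0::real^'n) 1"
  have "\<exists>v\<in>S. \<forall>y\<in>S. v \<bullet> (?a *v v) \<le> y \<bullet> (?a *v y)"
    by (rule continuous_attains_inf)
      (auto simp: S_def intro!: continuous_intros continuous_on_mat_vec_mult)
  then obtain v where v: "norm v = 1" and vmin: "\<And>y. norm y = 1 \<Longrightarrow> v \<bullet> (?a *v v) \<le> y \<bullet> (?a *v y)"
    by (auto simp: S_def)
  define e where "e = v \<bullet> (?a *v v)"
  have q: "e * (norm y)\<^sup>2 \<le> y \<bullet> (?a *v y)" for y
  proof (cases "y = 0")
    case False
    have "e \<le> ((1 / norm y) *\<^sub>R y) \<bullet> (?a *v ((1 / norm y) *\<^sub>R y))"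
      unfolding e_def by (rule vmin) (use False in simp)
    also have "\<dots> = (y \<bullet> (?a *v y)) / (norm y)\<^sup>2"
      by (simp add: matrix_vector_mult_scaleR power2_eq_square)
    finally show ?thesis using False by (simp add: field_simps)
  qed simp
  have "y \<bullet> (?a *v v - e *\<^sub>R v) = 0" for y
  proof -
    define B where "B = y \<bullet> (?a *v v - e *\<^sub>R v)"
    define D where "D = y \<bullet> (?a *v y) - e * (norm y)\<^sup>2"
    have sym: "v \<bullet> (?a *v y) = y \<bullet> (?a *v v)" by (simp add: inner_diffmat inner_commute)
    have nonneg: "0 \<le> 2 * t * B + t\<^sup>2 * D" for t
    proof -
      have "e * (norm (v + t *\<^sub>R y))\<^sup>2 \<le> (v + t *\<^sub>R y) \<bullet> (?a *v (v + t *\<^sub>R y))" by (rule q)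
      moreover have "(norm (v + t *\<^sub>R y))\<^sup>2 = 1 + 2 * t * (v \<bullet> y) + t\<^sup>2 * (norm y)\<^sup>2"
        using v unfolding power2_norm_eq_inner
        by (simp add: inner_add_left inner_add_right inner_commute power2_eq_square norm_eq_1)
      moreover have "(v + t *\<^sub>R y) \<bullet> (?a *v (v + t *\<^sub>R y)) = e + 2 * t * (y \<bullet> (?a *v v)) + t\<^sup>2 * (y \<bullet> (?a *v y))"
        by (simp add: matrix_vector_right_distrib matrix_vector_mult_scaleR inner_add_left inner_add_right
            sym e_def power2_eq_square algebra_simps)
      ultimately show ?thesis by (simp add: B_def D_def inner_diff_right inner_commute algebra_simps)
    qed
    have "D \<ge> 0" using q[of y] by (simp add: D_def)
    \<comment> \<open>The best choice of \<open>t\<close> would be \<open>- B / D\<close>; using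
      \<open>D + 1\<close> avoids the case \<open>D = 0\<close> and still forces
      \<open>B = 0\<close>.\<close>
    have "2 * B\<^sup>2 * (D + 1) \<le> B\<^sup>2 * D"
      using nonneg[of "- B / (D + 1)"] \<open>D \<ge> 0\<close> by (simp add: power2_eq_square divide_simps)
    then have "B\<^sup>2 * (D + 2) \<le> 0" by (simp add: algebra_simps)
    then have "B = 0" using \<open>D \<ge> 0\<close> by (simp add: mult_le_0_iff)
    then show ?thesis by (simp add: B_def)
  qed
  then have "?a *v v - e *\<^sub>R v = 0" using inner_eq_zero_iff by blast
  moreover have "v \<noteq> 0" using v by auto
  ultimately have "m \<le> e" using eig[of v e] by simp
  then have "m * (norm u)\<^sup>2 \<le> e * (norm u)\<^sup>2" by (rule mult_right_mono) simp
  with q[of u] show ?thesis by linarith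
qed

text \<open>The value at \<open>p\<close> is nonnegative because the open set \<open>Q\<close>
  misses \<open>p\<close>, and not positive because points of \<open>Q\<close>, where
  \<open>\<phi>\<close> is negative, accumulate there. A direction with negative derivative then
  enters \<open>Q\<close> to first order.\<close>

lemma frontier_inward_direction:
  assumes p: "p \<in> frontier Q" and loc: "local_defining_fun Q p r \<phi> D\<phi> D2\<phi>" and Q: "open Q"
  shows "\<phi> p = 0" and "D\<phi> p \<bullet> h < 0 \<Longrightarrow> \<exists>\<delta>>0. \<forall>t. 0 < t \<longrightarrow> t < \<delta> \<longrightarrow> p + t *\<^sub>R h \<in> Q"
proof -
  have r: "r > 0" and eq: "Q \<inter> ball p r = {x \<in> ball p r. \<phi> x < 0}"
    and der: "(\<phi> has_derivative (\<lambda>h. D\<phi> p \<bullet> h)) (at p)"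
    using loc by (auto simp: local_defining_fun_def C2_on_def)
  have "p \<notin> Q" "p \<in> closure Q" using p Q by (auto simp: frontier_def interior_open)
  then have "p \<notin> {x \<in> ball p r. \<phi> x < 0}" unfolding eq[symmetric] by blast
  then have ge: "\<phi> p \<ge> 0" using r by simp
  have "\<not> \<phi> p > 0"
  proof
    assume pos: "\<phi> p > 0"
    have "isCont \<phi> p" using der has_derivative_continuous by blast
    then have "\<forall>\<^sub>F x in nhds p. \<phi> x > 0"
      using pos by (auto simp: continuous_within tendsto_at_iff_tendsto_nhds intro: order_tendstoD)
    then obtain s where "s > 0" and s: "\<And>x. dist x p < s \<Longrightarrow> \<phi> x > 0" by (auto simp: eventually_nhds_metric)
    obtain x where "x \<in> Q" "dist x p < min s r"
      using \<open>p \<in> closure Q\<close> \<open>s > 0\<close> r unfolding closure_approachable by (metis min_less_iff_conj)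
    then have "x \<in> Q \<inter> ball p r" "\<phi> x > 0" using s by (auto simp: dist_commute)
    then show False using eq by auto
  qed
  with ge show p0: "\<phi> p = 0" by simp
  assume h: "D\<phi> p \<bullet> h < 0"
  have line: "((\<lambda>t. p + t *\<^sub>R h) has_derivative (\<lambda>s. s *\<^sub>R h)) (at 0)"
    by (auto intro!: derivative_eq_intros)
  have "((\<lambda>t. \<phi> (p + t *\<^sub>R h)) has_real_derivative D\<phi> p \<bullet> h) (at 0)"
    using has_derivative_compose[OF line, of \<phi> "\<lambda>h. D\<phi> p \<bullet> h"] der
    by (simp add: has_field_derivative_def mult_commute_abs)
  from DERIV_neg_dec_right[OF this h] p0
  obtain d where d: "d > 0" "\<And>t. 0 < t \<Longrightarrow> t < d \<Longrightarrow> \<phi> (p + t *\<^sub>R h) < 0" by auto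
  show "\<exists>\<delta>>0. \<forall>t. 0 < t \<longrightarrow> t < \<delta> \<longrightarrow> p + t *\<^sub>R h \<in> Q"
  proof (intro exI conjI allI impI)
    have "norm h > 0" using h by auto
    show "0 < min d (r / norm h)" using d r \<open>norm h > 0\<close> by simp
    fix t :: real assume t: "0 < t" "t < min d (r / norm h)"
    have "p + t *\<^sub>R h \<in> ball p r" using t \<open>norm h > 0\<close> by (simp add: dist_norm field_simps)
    with d(2) t eq show "p + t *\<^sub>R h \<in> Q" by auto
  qed
qed

lemma matrix_vector_mult_scaleR_left: "(r *\<^sub>R A) *v v = r *\<^sub>R (A *v v)" for A :: "real^'n^'m"
  by (simp add: matrix_vector_mult_def vec_eq_iff sum_distrib_left mult_ac)

lemma C2_gamma_scale:
  assumes "(f, Df, D2f) \<in> C2_gamma Q \<sigma>"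
  shows "((\<lambda>x. l * f x), (\<lambda>x. l *\<^sub>R Df x), (\<lambda>x. l *\<^sub>R D2f x)) \<in> C2_gamma Q \<sigma>"
  using assms unfolding C2_gamma_def C2_closure_def
  by (auto intro!: continuous_intros derivative_eq_intros simp: matrix_vector_mult_scaleR_left)

text \<open>At a boundary maximum the conormal condition kills the gradient, since the conormal is transversal.
  The quadratic form of the Hessian is then nonpositive on inward directions, hence by evenness and density
  on all directions, so boundary maxima behave like interior ones.\<close>
lemma C2_gamma_max_point:
  fixes \<sigma> :: "real^'n \<Rightarrow> real^'n^'n"
  assumes dom: "C2_domain Q" and w: "(w, Dw, D2w) \<in> C2_gamma Q \<sigma>"
    and p: "p \<in> closure Q" and pd: "\<And>v. v \<noteq> 0 \<Longrightarrow> 0 < v \<bullet> (diffmat \<sigma> p *v v)"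
    and max: "\<And>x. x \<in> closure Q \<Longrightarrow> w x \<le> w p"
  shows "Dw p = 0" and "trace (diffmat \<sigma> p ** D2w p) \<le> 0"
proof -
  have Q: "open Q" using dom by (simp add: C2_domain_def)
  have C2: "C2_closure Q w Dw D2w" using w by (simp add: C2_gamma_def)
  have maxQ: "w x \<le> w p" if "x \<in> Q" for x using max that closure_subset by blast
  have "Dw p = 0 \<and> (\<forall>h. (D2w p *v h) \<bullet> h \<le> 0)"
  proof (cases "p \<in> Q")
    case True
    have dir: "\<exists>\<delta>>0. \<forall>t. 0 < t \<longrightarrow> t < \<delta> \<longrightarrow> p + t *\<^sub>R h \<in> Q" for h
      using open_segment_start[OF Q True, of h] by metis
    have le: "Dw p \<bullet> h \<le> 0" for h using dir[of h] directional_max(1)[OF C2 p _ _ maxQ] by blast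
    have "Dw p \<bullet> Dw p \<le> 0" by (rule le)
    then have D0: "Dw p = 0" by (metis inner_ge_zero inner_eq_zero_iff order_antisym)
    moreover have "(D2w p *v h) \<bullet> h \<le> 0" for h
      using dir[of h] directional_max(2)[OF C2 p _ _ maxQ, of _ h] D0 by auto
    ultimately show ?thesis by blast
  next
    case False
    then have fr: "p \<in> frontier Q" using p Q by (simp add: frontier_def interior_open)
    then obtain r \<phi> D\<phi> D2\<phi> where loc: "local_defining_fun Q p r \<phi> D\<phi> D2\<phi>"
      using dom unfolding C2_domain_def by blast
    define n where "n = D\<phi> p"
    have n0: "n \<noteq> 0" using loc by (auto simp: local_defining_fun_def n_def)
    have dir: "\<exists>\<delta>>0. \<forall>t. 0 < t \<longrightarrow> t < \<delta> \<longrightarrow> p + t *\<^sub>R h \<in> Q" if "n \<bullet> h < 0" for h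
      using frontier_inward_direction(2)[OF fr loc Q] that by (simp add: n_def)
    have "outward_normal Q p ((1 / norm n) *\<^sub>R n)"
      unfolding outward_normal_def n_def using fr loc by blast
    then have "Dw p \<bullet> (diffmat \<sigma> p *v ((1 / norm n) *\<^sub>R n)) = 0" using w by (auto simp: C2_gamma_def)
    then have conormal: "Dw p \<bullet> (diffmat \<sigma> p *v n) = 0" using n0 by (simp add: matrix_vector_mult_scaleR)
    define u where "u = diffmat \<sigma> p *v n"
    have nu: "n \<bullet> u > 0" unfolding u_def by (rule pd[OF n0])
    have le: "Dw p \<bullet> h \<le> 0" for h
    proof -
      \<comment> \<open>Shifting \<open>h\<close> by this multiple of the conormal makes \<open>n
        \<bullet> (h - s *\<^sub>R u) = n \<bullet> h - \<bar>n \<bullet> h\<bar> - 1\<close>, which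
        is negative. The derivative of \<open>w\<close> does not notice the shift, so the inequality
        for inward directions extends to all.\<close>
      define s where "s = (\<bar>n \<bullet> h\<bar> + 1) / (n \<bullet> u)"
      have "n \<bullet> (h - s *\<^sub>R u) < 0" using nu by (simp add: inner_diff_right s_def)
      then have "Dw p \<bullet> (h - s *\<^sub>R u) \<le> 0" using dir directional_max(1)[OF C2 p _ _ maxQ] by blast
      then show ?thesis using conormal by (simp add: inner_diff_right u_def)
    qed
    have "Dw p \<bullet> Dw p \<le> 0" by (rule le)
    then have D0: "Dw p = 0" by (metis inner_ge_zero inner_eq_zero_iff order_antisym)
    define q where "q h = (D2w p *v h) \<bullet> h" for h
    have neg: "q h \<le> 0" if "n \<bullet> h < 0" for h
      unfolding q_def using dir[OF that] directional_max(2)[OF C2 p _ _ maxQ, of _ h] D0 by auto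
    have even: "q (- h) = q h" for h
      using matrix_vector_mult_scaleR[of "D2w p" "-1" h] by (simp add: q_def)
    have ne: "q h \<le> 0" if "n \<bullet> h \<noteq> 0" for h
      using neg[of h] neg[of "- h"] even[of h] that by (cases "n \<bullet> h < 0") auto
    have "q h \<le> 0" for h
    proof (cases "n \<bullet> h = 0")
      case True
      have "q (h + t *\<^sub>R n) \<le> 0" if "t > 0" for t
        using that n0 True by (intro ne) (simp add: inner_add_right)
      then have ev: "\<forall>\<^sub>F t in at_right 0. q (h + t *\<^sub>R n) \<le> 0" by (simp add: eventually_at_right_field) (use zero_less_one in blast)
      have "continuous_on UNIV q" unfolding q_def
        by (intro continuous_intros continuous_on_mat_vec_mult)
      from tendsto_at_right_along_segment[OF this, of h 1 n]
      have "((\<lambda>t. q (h + t *\<^sub>R n)) \<longlongrightarrow> q h) (at_right 0)" by simp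
      from tendsto_upperbound[OF this ev] show ?thesis by simp
    qed (rule ne)
    with D0 show ?thesis by (simp add: q_def)
  qed
  then show "Dw p = 0" "trace (diffmat \<sigma> p ** D2w p) \<le> 0"
    by (auto simp: trace_diffmat_mult intro!: sum_nonpos)
qed

lemma C2_gamma_min_point:
  fixes \<sigma> :: "real^'n \<Rightarrow> real^'n^'n"
  assumes dom: "C2_domain Q" and w: "(w, Dw, D2w) \<in> C2_gamma Q \<sigma>"
    and p: "p \<in> closure Q" and pd: "\<And>v. v \<noteq> 0 \<Longrightarrow> 0 < v \<bullet> (diffmat \<sigma> p *v v)"
    and min: "\<And>x. x \<in> closure Q \<Longrightarrow> w p \<le> w x"
  shows "Dw p = 0" and "0 \<le> trace (diffmat \<sigma> p ** D2w p)"
proof -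
  note neg = C2_gamma_max_point[OF dom C2_gamma_scale[OF w, of "-1"] p pd]
  have "(-1) *\<^sub>R Dw p = 0" by (rule neg(1)) (use min in auto)
  then show "Dw p = 0" by simp
  have "trace (diffmat \<sigma> p ** ((-1) *\<^sub>R D2w p)) \<le> 0" by (rule neg(2)) (use min in auto)
  then show "0 \<le> trace (diffmat \<sigma> p ** D2w p)"
    unfolding trace_diffmat_mult matrix_vector_mult_scaleR_left by (simp add: sum_negf)
qed

section \<open>Positivity of the eigenfunction\<close>

lemma gaussian_along_line:
  fixes q u :: "'a::real_inner" and \<alpha> :: real
  defines "e \<equiv> \<lambda>t. exp (- \<alpha> * (norm (q + t *\<^sub>R u))\<^sup>2)"
  defines "e' \<equiv> \<lambda>t. - 2 * \<alpha> * (q \<bullet> u + t * (norm u)\<^sup>2) * e t"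
  defines "e'' \<equiv> \<lambda>t. (4 * \<alpha>\<^sup>2 * (q \<bullet> u + t * (norm u)\<^sup>2)\<^sup>2 - 2 * \<alpha> * (norm u)\<^sup>2) * e t"
  shows "(e has_real_derivative e' t) (at t)" "(e' has_real_derivative e'' t) (at t)" "isCont e'' t"
proof -
  have e: "e = (\<lambda>t. exp (- \<alpha> * ((norm q)\<^sup>2 + 2 * t * (q \<bullet> u) + t\<^sup>2 * (norm u)\<^sup>2)))"
    unfolding e_def power2_norm_eq_inner
    by (simp add: fun_eq_iff inner_add_left inner_add_right inner_commute power2_eq_square algebra_simps)
  show e1: "(e has_real_derivative e' t) (at t)" for t
    unfolding e'_def unfolding e by (auto intro!: derivative_eq_intros simp: algebra_simps)
  show "(e' has_real_derivative e'' t) (at t)"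
    unfolding e'_def[abs_def] e''_def
    by (rule derivative_eq_intros e1 refl)+ (simp add: e'_def power2_eq_square algebra_simps)
  have "isCont e t" using e1 DERIV_isCont by blast
  then show "isCont e'' t" unfolding e''_def[abs_def] by (intro continuous_intros)
qed

text \<open>The endpoint test is applied to the Gaussian minus \<open>w\<close>. Minimality is
  required along one ray only, so the lemma covers both an interior minimum in the annulus and the
  touching point on the outer sphere, from which only inward rays are available.\<close>

lemma C2_min_gaussian_comparison:
  fixes w :: "real^'n \<Rightarrow> real"
  assumes w: "C2_closure Q w Dw D2w" and p: "p \<in> closure Q" and \<delta>: "0 < \<delta>"
    and seg: "\<And>t. 0 < t \<Longrightarrow> t < \<delta> \<Longrightarrow> p + t *\<^sub>R u \<in> Q"
    and min: "\<And>t. 0 < t \<Longrightarrow> t < \<delta> \<Longrightarrow>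
      w p - \<epsilon> * exp (- \<alpha> * (norm (p - y))\<^sup>2) \<le> w (p + t *\<^sub>R u) - \<epsilon> * exp (- \<alpha> * (norm (p + t *\<^sub>R u - y))\<^sup>2)"
  defines "E \<equiv> \<epsilon> * exp (- \<alpha> * (norm (p - y))\<^sup>2)"
  shows "- 2 * \<alpha> * ((p - y) \<bullet> u) * E \<le> Dw p \<bullet> u"
    and "Dw p \<bullet> u = - 2 * \<alpha> * ((p - y) \<bullet> u) * E \<Longrightarrow>
      (4 * \<alpha>\<^sup>2 * ((p - y) \<bullet> u)\<^sup>2 - 2 * \<alpha> * (norm u)\<^sup>2) * E \<le> (D2w p *v u) \<bullet> u"
proof -
  define e where "e t = exp (- \<alpha> * (norm ((p - y) + t *\<^sub>R u))\<^sup>2)" for t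
  define e' where "e' t = - 2 * \<alpha> * ((p - y) \<bullet> u + t * (norm u)\<^sup>2) * e t" for t
  define e'' where "e'' t = (4 * \<alpha>\<^sup>2 * ((p - y) \<bullet> u + t * (norm u)\<^sup>2)\<^sup>2 - 2 * \<alpha> * (norm u)\<^sup>2) * e t" for t
  have e: "(e has_real_derivative e' t) (at t)" "(e' has_real_derivative e'' t) (at t)" "isCont e'' t" for t
    using gaussian_along_line[where \<alpha> = \<alpha> and q = "p - y" and u = u and t = t] unfolding e_def e'_def e''_def by auto
  have "isCont e t" "isCont e' t" for t using e DERIV_isCont by blast+
  then have elim: "(e \<longlongrightarrow> e 0) (at_right 0)" "(e' \<longlongrightarrow> e' 0) (at_right 0)" "(e'' \<longlongrightarrow> e'' 0) (at_right 0)"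
    using e(3)[of 0] by (auto simp: isCont_def intro: tendsto_within_subset)
  note f = C2_closure_along_segment[OF w p \<delta> seg]
  define g where "g t = \<epsilon> * e t - w (p + t *\<^sub>R u)" for t
  define g' where "g' t = \<epsilon> * e' t - Dw (p + t *\<^sub>R u) \<bullet> u" for t
  define g'' where "g'' t = \<epsilon> * e'' t - (D2w (p + t *\<^sub>R u) *v u) \<bullet> u" for t
  have d: "(g has_real_derivative g' t) (at t)" "(g' has_real_derivative g'' t) (at t)" if "0 < t" "t < \<delta>" for t
    unfolding g_def[abs_def] g'_def[abs_def] g''_def
    by (intro DERIV_diff DERIV_cmult e f that; assumption)+
  have l: "(g \<longlongrightarrow> g 0) (at_right 0)" "(g' \<longlongrightarrow> g' 0) (at_right 0)" "(g'' \<longlongrightarrow> g'' 0) (at_right 0)"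
    unfolding g_def[abs_def] g'_def[abs_def] g''_def[abs_def]
    by (intro tendsto_diff tendsto_mult_left elim f; assumption)+
  have m: "g t \<le> g 0" if "0 < t" "t < \<delta>" for t
    using min[OF that] by (simp add: g_def e_def algebra_simps)
  have "g' 0 \<le> 0"
    by (rule endpoint_max_derivatives(1)[OF \<delta>, of g g' g'']) (rule d l m | assumption)+
  then show "- 2 * \<alpha> * ((p - y) \<bullet> u) * E \<le> Dw p \<bullet> u"
    by (simp add: g'_def e'_def e_def E_def algebra_simps)
  have "g' 0 = 0 \<Longrightarrow> g'' 0 \<le> 0"
    by (rule endpoint_max_derivatives(2)[OF \<delta>, of g g' g'']) (rule d l m | assumption)+
  then show "(4 * \<alpha>\<^sup>2 * ((p - y) \<bullet> u)\<^sup>2 - 2 * \<alpha> * (norm u)\<^sup>2) * E \<le> (D2w p *v u) \<bullet> u"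
    if "Dw p \<bullet> u = - 2 * \<alpha> * ((p - y) \<bullet> u) * E"
    using that by (simp add: g'_def g''_def e'_def e''_def e_def E_def algebra_simps)
qed

text \<open>The barrier is a Gaussian centred at \<open>y\<close>; \<open>\<alpha>\<close> is chosen so large that it is a strict subsolution on the
  annulus \<open>R / 2 < dist y x < R\<close>.\<close>
lemma hopf_boundary_point:
  fixes \<sigma> :: "real^'n \<Rightarrow> real^'n^'n" and V :: "real^'n \<Rightarrow> real"
  assumes V: "C2_closure Q V DV D2V" and nonneg: "\<And>x. x \<in> closure Q \<Longrightarrow> 0 \<le> V x"
    and m: "0 < m" "\<And>x v. x \<in> Q \<Longrightarrow> m * (norm v)\<^sup>2 \<le> v \<bullet> (diffmat \<sigma> x *v v)"
    and T: "\<And>x. x \<in> Q \<Longrightarrow> (\<Sum>i\<in>UNIV. (norm (column i (\<sigma> x)))\<^sup>2) \<le> T"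
    and \<beta>: "\<And>x. x \<in> Q \<Longrightarrow> norm (\<beta> x) \<le> B"
    and k: "0 \<le> k"
    and super: "\<And>x. x \<in> Q \<Longrightarrow> trace (diffmat \<sigma> x ** D2V x) / 2 + \<beta> x \<bullet> DV x - k * V x \<le> 0"
    and R: "0 < R" "ball y R \<subseteq> Q" "\<And>x. x \<in> ball y R \<Longrightarrow> 0 < V x"
    and x0: "dist y x0 = R" "V x0 = 0"
  shows "DV x0 \<noteq> 0"
proof
  assume DV0: "DV x0 = 0"
  have ballc: "cball y R \<subseteq> closure Q"
    using closure_mono[OF R(2)] R(1) by simp
  have "y \<in> Q" using R by auto
  have B0: "0 \<le> B" using \<beta>[OF \<open>y \<in> Q\<close>] norm_ge_zero order_trans by blast
  have T0: "0 \<le> T" using T[OF \<open>y \<in> Q\<close>] by (rule order_trans[rotated]) (auto intro: sum_nonneg)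
  \<comment> \<open>For \<open>R / 2 \<le> norm (z - y) \<le> R\<close>, ellipticity makes the
    second-order gain at least \<open>\<alpha>\<^sup>2 * c1\<close> times the Gaussian. The trace
    bound and the drift cost at most \<open>\<alpha> * c2\<close> times it, and the zero-order term
    at most \<open>k\<close> times.\<close>
  define c1 where "c1 = m * R\<^sup>2 / 2"
  define c2 where "c2 = T + 2 * B * R"
  have c1: "c1 > 0" using m(1) R(1) by (simp add: c1_def)
  have c2: "c2 \<ge> 0" using B0 T0 R(1) by (simp add: c2_def)
  \<comment> \<open>With this value \<open>\<alpha>\<^sup>2 * c1\<close> equals
    \<open>\<alpha> * (c1 + c2 + k)\<close>, which exceeds \<open>\<alpha> * c2 + k\<close> because
    \<open>\<alpha> \<ge> 1\<close>.\<close>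
  define \<alpha> where "\<alpha> = 1 + (c2 + k) / c1"
  have \<alpha>1: "\<alpha> \<ge> 1" using c1 c2 k by (simp add: \<alpha>_def)
  have "\<alpha>\<^sup>2 * c1 = \<alpha> * (c1 + c2 + k)" using c1 by (simp add: \<alpha>_def power2_eq_square field_simps)
  moreover have "k \<le> \<alpha> * k" "0 < \<alpha> * c1" using \<alpha>1 k c1 by (auto simp: mult_le_cancel_right1)
  ultimately have key: "0 < \<alpha>\<^sup>2 * c1 - \<alpha> * c2 - k" by (simp add: algebra_simps)
  define S where "S = sphere y (R / 2)"
  have Sball: "S \<subseteq> ball y R" using R(1) by (auto simp: S_def)
  have Vc: "continuous_on (closure Q) V" using V by (simp add: C2_closure_def)
  have "\<exists>v\<in>S. \<forall>x\<in>S. V v \<le> V x"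
  proof (rule continuous_attains_inf)
    show "compact S" by (simp add: S_def)
    show "S \<noteq> {}" using R(1) by (simp add: S_def)
    show "continuous_on S V"
      by (rule continuous_on_subset[OF Vc]) (use Sball ballc ball_subset_cball in blast)
  qed
  then obtain v where v: "v \<in> S" "\<And>x. x \<in> S \<Longrightarrow> V v \<le> V x" by blast
  \<comment> \<open>Being the minimum of \<open>V\<close> on the inner sphere,
    \<open>\<epsilon>\<close> keeps the barrier below \<open>V\<close> there, since the Gaussian
    never exceeds 1.\<close>
  define \<epsilon> where "\<epsilon> = V v"
  have \<epsilon>: "\<epsilon> > 0" using R(3) v(1) Sball by (auto simp: \<epsilon>_def)
  define E where "E x = exp (- \<alpha> * (norm (x - y))\<^sup>2)" for x
  define w where "w x = V x - \<epsilon> * E x" for x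
  \<comment> \<open>This is the value of \<open>w\<close> at \<open>x0\<close> and its lower bound
    on the outer sphere. Comparing \<open>w\<close> with \<open>c\<close> replaces subtracting a
    constant from the Gaussian to make it vanish on that sphere.\<close>
  define c where "c = - \<epsilon> * exp (- \<alpha> * R\<^sup>2)"
  define A where "A = cball y R - ball y (R / 2)"
  have A: "x \<in> A \<longleftrightarrow> R / 2 \<le> norm (x - y) \<and> norm (x - y) \<le> R" for x
    by (auto simp: A_def dist_norm norm_minus_commute)
  have x0A: "x0 \<in> A" using x0(1) R(1) by (simp add: A dist_norm norm_minus_commute)
  have "\<exists>z\<in>A. \<forall>x\<in>A. w z \<le> w x"
  proof (rule continuous_attains_inf)
    show "compact A" unfolding A_def by (rule compact_diff) auto
    show "A \<noteq> {}" using x0A by blast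
    have "continuous_on A V" by (rule continuous_on_subset[OF Vc]) (use ballc in \<open>auto simp: A_def\<close>)
    then show "continuous_on A w" unfolding w_def E_def by (intro continuous_intros)
  qed
  then obtain z where z: "z \<in> A" and zmin: "\<And>x. x \<in> A \<Longrightarrow> w z \<le> w x" by blast
  have wx0: "w x0 = c" using x0 by (simp add: w_def c_def E_def dist_norm norm_minus_commute)
  \<comment> \<open>A minimum below \<open>c\<close> cannot lie on the outer sphere, where
    \<open>V\<close> is nonnegative, nor on the inner one, where \<open>w \<ge> 0 \<ge> c\<close>.
    In the open annulus it would contradict the strict subsolution property.\<close>
  have zc: "c \<le> w z"
  proof (rule ccontr)
    assume "\<not> c \<le> w z"
    then have lt: "w z < c" by simp
    have "norm (z - y) \<noteq> R"
    proof
      assume "norm (z - y) = R"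
      moreover have "0 \<le> V z" using z ballc by (intro nonneg) (auto simp: A_def)
      ultimately show False using lt by (simp add: w_def E_def c_def)
    qed
    moreover have "norm (z - y) \<noteq> R / 2"
    proof
      assume "norm (z - y) = R / 2"
      then have "z \<in> S" by (simp add: S_def dist_norm norm_minus_commute)
      then have "\<epsilon> \<le> V z" using v(2) by (simp add: \<epsilon>_def)
      moreover have "\<epsilon> * E z \<le> \<epsilon> * 1" using \<epsilon> \<alpha>1 by (intro mult_left_mono) (auto simp: E_def)
      ultimately have "0 \<le> w z" by (simp add: w_def)
      moreover have "c \<le> 0" using \<epsilon> by (simp add: c_def)
      ultimately show False using lt by simp
    qed
    ultimately have zin: "R / 2 < norm (z - y)" "norm (z - y) < R" using z by (auto simp: A)
    define U where "U = ball y R - cball y (R / 2)"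
    have U: "open U" "z \<in> U" "U \<subseteq> A" "U \<subseteq> Q"
      using zin R(2) by (auto simp: U_def A_def dist_norm norm_minus_commute)
    have zQ: "z \<in> Q" and zcl: "z \<in> closure Q" using U closure_subset by auto
    define Ez where "Ez = \<epsilon> * E z"
    have Ez: "Ez > 0" using \<epsilon> by (simp add: Ez_def E_def)
    have grad_ge: "- 2 * \<alpha> * ((z - y) \<bullet> u) * Ez \<le> DV z \<bullet> u"
      and hess: "DV z \<bullet> u = - 2 * \<alpha> * ((z - y) \<bullet> u) * Ez \<Longrightarrow>
        (4 * \<alpha>\<^sup>2 * ((z - y) \<bullet> u)\<^sup>2 - 2 * \<alpha> * (norm u)\<^sup>2) * Ez \<le> (D2V z *v u) \<bullet> u" for u
    proof -
      obtain \<delta> where \<delta>: "0 < \<delta>" and seg: "\<And>t. 0 < t \<Longrightarrow> t < \<delta> \<Longrightarrow> z + t *\<^sub>R u \<in> U"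
        using open_segment_start[OF U(1,2), of u] by blast
      have segQ: "\<And>t. 0 < t \<Longrightarrow> t < \<delta> \<Longrightarrow> z + t *\<^sub>R u \<in> Q" using seg U(4) by blast
      have mn: "V z - \<epsilon> * exp (- \<alpha> * (norm (z - y))\<^sup>2) \<le> V (z + t *\<^sub>R u) - \<epsilon> * exp (- \<alpha> * (norm (z + t *\<^sub>R u - y))\<^sup>2)"
        if "0 < t" "t < \<delta>" for t
        using zmin[of "z + t *\<^sub>R u"] seg[OF that] U(3) by (auto simp: w_def E_def)
      show "- 2 * \<alpha> * ((z - y) \<bullet> u) * Ez \<le> DV z \<bullet> u"
        unfolding Ez_def E_def by (rule C2_min_gaussian_comparison(1)[OF V zcl \<delta>]) (rule segQ mn; assumption)+
      show "(4 * \<alpha>\<^sup>2 * ((z - y) \<bullet> u)\<^sup>2 - 2 * \<alpha> * (norm u)\<^sup>2) * Ez \<le> (D2V z *v u) \<bullet> u"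
        if "DV z \<bullet> u = - 2 * \<alpha> * ((z - y) \<bullet> u) * Ez"
        using that unfolding Ez_def E_def
        by (rule C2_min_gaussian_comparison(2)[OF V zcl \<delta>, rotated 2]) (rule segQ mn; assumption)+
    qed
    \<comment> \<open>An interior point admits both \<open>u\<close> and \<open>- u\<close>, which
      turns the one-sided inequality into an equality and unlocks \<open>hess\<close>.\<close>
    have grad: "DV z \<bullet> u = - 2 * \<alpha> * ((z - y) \<bullet> u) * Ez" for u
      using grad_ge[of u] grad_ge[of "- u"] by simp
    define s where "s i = column i (\<sigma> z)" for i
    have "trace (diffmat \<sigma> z ** D2V z) = (\<Sum>i\<in>UNIV. (D2V z *v s i) \<bullet> s i)"
      unfolding s_def by (rule trace_diffmat_mult)
    also have "\<dots> \<ge> (\<Sum>i\<in>UNIV. (4 * \<alpha>\<^sup>2 * ((z - y) \<bullet> s i)\<^sup>2 - 2 * \<alpha> * (norm (s i))\<^sup>2) * Ez)"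
      by (intro sum_mono hess grad)
    also have "(\<Sum>i\<in>UNIV. (4 * \<alpha>\<^sup>2 * ((z - y) \<bullet> s i)\<^sup>2 - 2 * \<alpha> * (norm (s i))\<^sup>2) * Ez) =
        (4 * \<alpha>\<^sup>2 * (\<Sum>i\<in>UNIV. (s i \<bullet> (z - y))\<^sup>2) - 2 * \<alpha> * (\<Sum>i\<in>UNIV. (norm (s i))\<^sup>2)) * Ez"
      by (simp add: sum_distrib_right[symmetric] sum_subtractf sum_distrib_left[symmetric] inner_commute)
    also have "(\<Sum>i\<in>UNIV. (s i \<bullet> (z - y))\<^sup>2) = (z - y) \<bullet> (diffmat \<sigma> z *v (z - y))"
      unfolding s_def norm_transpose_mult_eq_sum[symmetric] inner_diffmat power2_norm_eq_inner ..
    finally have tr: "(4 * \<alpha>\<^sup>2 * ((z - y) \<bullet> (diffmat \<sigma> z *v (z - y))) - 2 * \<alpha> * (\<Sum>i\<in>UNIV. (norm (s i))\<^sup>2)) * Ez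
        \<le> trace (diffmat \<sigma> z ** D2V z)" .
    have "m * (R / 2)\<^sup>2 \<le> m * (norm (z - y))\<^sup>2" using zin(1) R(1) m(1) by (intro mult_left_mono power_mono) auto
    also have "\<dots> \<le> (z - y) \<bullet> (diffmat \<sigma> z *v (z - y))" by (rule m(2)[OF zQ])
    finally have "4 * \<alpha>\<^sup>2 * (m * (R / 2)\<^sup>2) \<le> 4 * \<alpha>\<^sup>2 * ((z - y) \<bullet> (diffmat \<sigma> z *v (z - y)))"
      by (intro mult_left_mono) auto
    moreover have "4 * \<alpha>\<^sup>2 * (m * (R / 2)\<^sup>2) = 2 * \<alpha>\<^sup>2 * c1" by (simp add: c1_def power2_eq_square)
    moreover have "2 * \<alpha> * (\<Sum>i\<in>UNIV. (norm (s i))\<^sup>2) \<le> 2 * \<alpha> * T"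
      using T[OF zQ] \<alpha>1 by (intro mult_left_mono) (auto simp: s_def)
    ultimately have "2 * \<alpha>\<^sup>2 * c1 - 2 * \<alpha> * T \<le>
        4 * \<alpha>\<^sup>2 * ((z - y) \<bullet> (diffmat \<sigma> z *v (z - y))) - 2 * \<alpha> * (\<Sum>i\<in>UNIV. (norm (s i))\<^sup>2)" by linarith
    then have "(2 * \<alpha>\<^sup>2 * c1 - 2 * \<alpha> * T) * Ez \<le> trace (diffmat \<sigma> z ** D2V z)"
      using tr Ez by (meson mult_right_mono less_imp_le order_trans)
    then have t1: "(\<alpha>\<^sup>2 * c1 - \<alpha> * T) * Ez \<le> trace (diffmat \<sigma> z ** D2V z) / 2" by (simp add: algebra_simps)
    have "(z - y) \<bullet> \<beta> z \<le> norm (z - y) * norm (\<beta> z)" by (rule norm_cauchy_schwarz)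
    also have "\<dots> \<le> R * B" using zin \<beta>[OF zQ] R(1) by (intro mult_mono) auto
    finally have "2 * \<alpha> * ((z - y) \<bullet> \<beta> z) * Ez \<le> 2 * \<alpha> * (R * B) * Ez"
      using \<alpha>1 Ez by (intro mult_right_mono mult_left_mono) auto
    then have t2: "- (2 * \<alpha> * (R * B)) * Ez \<le> \<beta> z \<bullet> DV z"
      using grad[of "\<beta> z"] by (simp add: inner_commute)
    \<comment> \<open>From \<open>w z < c\<close> and \<open>c \<le> 0\<close>: at the supposed
      minimum \<open>V\<close> lies below the barrier, so the term \<open>- k * V z\<close> loses at
      most \<open>k * Ez\<close>.\<close>
    have "V z \<le> Ez" using lt \<epsilon> by (simp add: w_def Ez_def c_def) (smt (verit) exp_gt_zero mult_pos_pos)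
    then have t3: "- (k * Ez) \<le> - (k * V z)" using k by (simp add: mult_left_mono)
    have "(\<alpha>\<^sup>2 * c1 - \<alpha> * c2 - k) * Ez \<le> trace (diffmat \<sigma> z ** D2V z) / 2 + \<beta> z \<bullet> DV z - k * V z"
      using t1 t2 t3 by (simp add: c2_def algebra_simps)
    also have "\<dots> \<le> 0" by (rule super[OF zQ])
    finally show False using key Ez by (simp add: mult_le_0_iff)
  qed
  have seg: "x0 + t *\<^sub>R (y - x0) \<in> ball y R" "x0 + t *\<^sub>R (y - x0) \<in> A" if t: "0 < t" "t < 1 / 2" for t
  proof -
    have "x0 + t *\<^sub>R (y - x0) - y = (1 - t) *\<^sub>R (x0 - y)" by (simp add: algebra_simps)
    then have nt: "norm (x0 + t *\<^sub>R (y - x0) - y) = (1 - t) * R"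
      using t x0(1) by (simp add: dist_norm norm_minus_commute)
    have lt: "R / 2 \<le> (1 - t) * R" "(1 - t) * R < R" using t R(1) by (auto simp: field_simps)
    show "x0 + t *\<^sub>R (y - x0) \<in> ball y R" unfolding mem_ball dist_norm norm_minus_commute[of y] nt by (rule lt)
    show "x0 + t *\<^sub>R (y - x0) \<in> A" unfolding A nt by (rule conjI[OF lt(1) less_imp_le[OF lt(2)]])
  qed
  \<comment> \<open>Now \<open>x0\<close> minimises \<open>w\<close> on the annulus. Along the
    inward radius, \<open>V\<close> must grow at least as fast as the barrier, whose slope there is
    strictly positive, against \<open>DV0\<close>.\<close>
  have "- 2 * \<alpha> * ((x0 - y) \<bullet> (y - x0)) * (\<epsilon> * exp (- \<alpha> * (norm (x0 - y))\<^sup>2)) \<le> DV x0 \<bullet> (y - x0)"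
  proof (rule C2_min_gaussian_comparison(1)[OF V, where \<delta> = "1 / 2"])
    show "x0 \<in> closure Q" using x0A ballc by (auto simp: A_def)
    show "x0 + t *\<^sub>R (y - x0) \<in> Q" if "0 < t" "t < 1 / 2" for t using seg(1)[OF that] R(2) by blast
    show "V x0 - \<epsilon> * exp (- \<alpha> * (norm (x0 - y))\<^sup>2) \<le>
        V (x0 + t *\<^sub>R (y - x0)) - \<epsilon> * exp (- \<alpha> * (norm (x0 + t *\<^sub>R (y - x0) - y))\<^sup>2)"
      if "0 < t" "t < 1 / 2" for t
    proof -
      have "w x0 \<le> w (x0 + t *\<^sub>R (y - x0))" using wx0 zc zmin[OF seg(2)[OF that]] by linarith
      then show ?thesis by (simp add: w_def E_def)
    qed
  qed simp
  moreover have "(x0 - y) \<bullet> (y - x0) = - R\<^sup>2"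
    using x0(1) power2_norm_eq_inner[of "y - x0"] by (simp add: dist_norm inner_diff_left inner_diff_right)
  ultimately have "2 * \<alpha> * R\<^sup>2 * (\<epsilon> * exp (- \<alpha> * (norm (x0 - y))\<^sup>2)) \<le> 0" using DV0 by simp
  moreover have "0 < 2 * \<alpha> * R\<^sup>2 * (\<epsilon> * exp (- \<alpha> * (norm (x0 - y))\<^sup>2))" using \<alpha>1 R(1) \<epsilon> by (intro mult_pos_pos) auto
  ultimately show False by linarith
qed

text \<open>For a point \<open>p + h\<close> of a small ball touching \<open>p\<close> from the
  inner side, the inner product of \<open>h\<close> with the normal is below
  \<open>- (norm h)\<^sup>2 / (2 * R)\<close>. For small \<open>R\<close> this first-order decrease
  of \<open>\<phi>\<close> beats the quadratic Taylor error.\<close>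

lemma C2_domain_interior_ball:
  fixes Q :: "(real^'n) set"
  assumes dom: "C2_domain Q" and p: "p \<in> frontier Q"
  obtains y R where "0 < R" "ball y R \<subseteq> Q" "dist y p = R"
proof -
  have Q: "open Q" using dom by (simp add: C2_domain_def)
  obtain r \<phi> D\<phi> D2\<phi> where loc: "local_defining_fun Q p r \<phi> D\<phi> D2\<phi>"
    using dom p unfolding C2_domain_def by blast
  then have r: "r > 0" and eq: "Q \<inter> ball p r = {x \<in> ball p r. \<phi> x < 0}"
    and der: "\<And>x. x \<in> ball p r \<Longrightarrow> (\<phi> has_derivative (\<lambda>h. D\<phi> x \<bullet> h)) (at x)"
    and der2: "(D\<phi> has_derivative (\<lambda>h. D2\<phi> p *v h)) (at p)" and n0: "D\<phi> p \<noteq> 0"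
    by (auto simp: local_defining_fun_def C2_on_def)
  have \<phi>p: "\<phi> p = 0" using frontier_inward_direction(1)[OF p loc Q] .
  \<comment> \<open>Differentiability of \<open>D\<phi>\<close> at the single point \<open>p\<close>
    yields a Lipschitz estimate based at \<open>p\<close>; the added 1 absorbs the error of the
    linear approximation.\<close>
  define C where "C = onorm (\<lambda>h. D2\<phi> p *v h) + 1"
  obtain d where d: "d > 0" "\<And>x. norm (x - p) < d \<Longrightarrow> norm (D\<phi> x - D\<phi> p) \<le> C * norm (x - p)"
  proof -
    have bl: "bounded_linear (\<lambda>h. D2\<phi> p *v h)" using der2 by (rule has_derivative_bounded_linear)
    from der2 obtain d where d: "d > 0"
      "\<And>x. norm (x - p) < d \<Longrightarrow> norm (D\<phi> x - D\<phi> p - D2\<phi> p *v (x - p)) \<le> 1 * norm (x - p)"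
      unfolding has_derivative_at_alt by (metis zero_less_one)
    have "norm (D\<phi> x - D\<phi> p) \<le> C * norm (x - p)" if "norm (x - p) < d" for x
    proof -
      have "norm (D\<phi> x - D\<phi> p) \<le> norm (D2\<phi> p *v (x - p)) + norm (D\<phi> x - D\<phi> p - D2\<phi> p *v (x - p))"
        using norm_triangle_ineq[of "D2\<phi> p *v (x - p)" "D\<phi> x - D\<phi> p - D2\<phi> p *v (x - p)"] by simp
      also have "\<dots> \<le> onorm (\<lambda>h. D2\<phi> p *v h) * norm (x - p) + 1 * norm (x - p)"
        by (intro add_mono onorm[OF bl] d that)
      finally show ?thesis by (simp add: C_def algebra_simps)
    qed
    with d(1) show thesis by (rule that)
  qed
  have C: "C > 0" unfolding C_def using onorm_pos_le[OF has_derivative_bounded_linear[OF der2]] by simp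
  define g where "g = norm (D\<phi> p)"
  have g: "g > 0" using n0 by (simp add: g_def)
  define n where "n = (1 / g) *\<^sub>R D\<phi> p"
  have nn: "norm n = 1" using g by (simp add: n_def g_def)
  \<comment> \<open>Points of the ball lie within \<open>2 * R\<close> of \<open>p\<close>, hence
    inside both neighbourhoods of radius \<open>r\<close> and \<open>d\<close>. The last entry gives
    \<open>2 * R * C \<le> g\<close>, by which the normal term dominates.\<close>
  define R where "R = min (min r d / 2) (g / (2 * C))"
  have R: "R > 0" "2 * R \<le> r" "2 * R \<le> d" "2 * R * C \<le> g"
  proof -
    show "R > 0" using r d(1) g C by (simp add: R_def)
    have "R \<le> min r d / 2" "R \<le> g / (2 * C)" by (auto simp: R_def)
    then show "2 * R \<le> r" "2 * R \<le> d" "2 * R * C \<le> g" using C by (auto simp: field_simps)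
  qed
  define y where "y = p - R *\<^sub>R n"
  have py: "dist y p = R" using R(1) nn by (simp add: y_def dist_norm)
  have "x \<in> Q" if x: "x \<in> ball y R" for x
  proof -
    define h where "h = x - p"
    have "norm (h + R *\<^sub>R n) < R" using x by (simp add: y_def h_def dist_norm norm_minus_commute algebra_simps)
    then have "(norm (h + R *\<^sub>R n))\<^sup>2 < R\<^sup>2" by (intro power_strict_mono) auto
    moreover have "(norm (h + R *\<^sub>R n))\<^sup>2 = (norm h)\<^sup>2 + 2 * R * (h \<bullet> n) + R\<^sup>2"
      using nn unfolding power2_norm_eq_inner
      by (simp add: inner_add_left inner_add_right inner_commute norm_eq_1 power2_eq_square)
    ultimately have hn: "2 * R * (h \<bullet> n) < - (norm h)\<^sup>2" by linarith
    then have h0: "h \<noteq> 0" by auto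
    have "norm h \<le> norm (h + R *\<^sub>R n) + norm (R *\<^sub>R n)" using norm_triangle_ineq4[of "h + R *\<^sub>R n" "R *\<^sub>R n"] by simp
    then have hR: "norm h < 2 * R" using \<open>norm (h + R *\<^sub>R n) < R\<close> nn R(1) by simp
    have inb: "p + t *\<^sub>R h \<in> ball p r" if "0 \<le> t" "t \<le> 1" for t
    proof -
      have "t * norm h \<le> 1 * norm h" using that by (intro mult_right_mono) auto
      then show ?thesis using hR R(2) that by (simp add: dist_norm)
    qed
    have "\<exists>t. 0 < t \<and> t < 1 \<and> \<phi> (p + 1 *\<^sub>R h) - \<phi> (p + 0 *\<^sub>R h) = (1 - 0) * (D\<phi> (p + t *\<^sub>R h) \<bullet> h)"
    proof (rule MVT2[of 0 1 "\<lambda>t. \<phi> (p + t *\<^sub>R h)"])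
      fix t :: real assume t: "0 \<le> t" "t \<le> 1"
      have line: "((\<lambda>t. p + t *\<^sub>R h) has_derivative (\<lambda>s. s *\<^sub>R h)) (at t)"
        by (auto intro!: derivative_eq_intros)
      show "((\<lambda>t. \<phi> (p + t *\<^sub>R h)) has_real_derivative D\<phi> (p + t *\<^sub>R h) \<bullet> h) (at t)"
        using has_derivative_compose[OF line der[OF inb[OF t]]]
        by (simp add: has_field_derivative_def mult_commute_abs)
    qed simp
    then obtain t where t: "0 < t" "t < 1" and \<phi>x: "\<phi> x = D\<phi> (p + t *\<^sub>R h) \<bullet> h" by (auto simp: h_def \<phi>p)
    have "t * norm h \<le> 1 * norm h" using t by (intro mult_right_mono) auto
    have "norm (D\<phi> (p + t *\<^sub>R h) - D\<phi> p) \<le> C * norm (t *\<^sub>R h)"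
      using d(2)[of "p + t *\<^sub>R h"] \<open>t * norm h \<le> 1 * norm h\<close> hR R(3) t by simp
    also have "\<dots> \<le> C * norm h" using C t \<open>t * norm h \<le> 1 * norm h\<close> by simp
    finally have Dd: "norm (D\<phi> (p + t *\<^sub>R h) - D\<phi> p) \<le> C * norm h" .
    have "(D\<phi> (p + t *\<^sub>R h) - D\<phi> p) \<bullet> h \<le> norm (D\<phi> (p + t *\<^sub>R h) - D\<phi> p) * norm h" by (rule norm_cauchy_schwarz)
    also have "\<dots> \<le> C * norm h * norm h" using Dd by (intro mult_right_mono) auto
    finally have "\<phi> x \<le> D\<phi> p \<bullet> h + C * (norm h)\<^sup>2" using \<phi>x by (simp add: inner_diff_left power2_eq_square)
    moreover have "D\<phi> p \<bullet> h = g * (h \<bullet> n)" using g by (simp add: n_def inner_commute)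
    ultimately have "2 * R * \<phi> x \<le> 2 * R * (g * (h \<bullet> n) + C * (norm h)\<^sup>2)" using R(1) by (intro mult_left_mono) auto
    also have "\<dots> = g * (2 * R * (h \<bullet> n)) + 2 * R * C * (norm h)\<^sup>2" by (simp add: algebra_simps)
    also have "\<dots> < g * (- (norm h)\<^sup>2) + g * (norm h)\<^sup>2"
      using hn g R(4) by (intro add_less_le_mono mult_strict_left_mono mult_right_mono) auto
    finally have "\<phi> x < 0" using R(1) by (simp add: mult_less_0_iff)
    moreover have "x \<in> ball p r" using inb[of 1] by (simp add: h_def)
    ultimately show ?thesis using eq by blast
  qed
  with R(1) py show thesis by (intro that[of R y]) auto
qed

text \<open>Hopf's lemma contradicts the vanishing of the gradient at a zero of \<open>V\<close>, which is a minimum: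
  a zero inside the domain is reached by a ball of positivity by connectedness,
  a zero on the boundary by the interior ball condition.\<close>
lemma C2_gamma_supersolution_positive:
  fixes \<sigma> :: "real^'n \<Rightarrow> real^'n^'n" and V :: "real^'n \<Rightarrow> real"
  assumes dom: "C2_domain Q" and VG: "(V, DV, D2V) \<in> C2_gamma Q \<sigma>"
    and nonneg: "\<And>x. x \<in> closure Q \<Longrightarrow> 0 \<le> V x" and ne: "q0 \<in> Q" "0 < V q0"
    and m: "0 < m" "\<And>x v. x \<in> closure Q \<Longrightarrow> m * (norm v)\<^sup>2 \<le> v \<bullet> (diffmat \<sigma> x *v v)"
    and T: "\<And>x. x \<in> Q \<Longrightarrow> (\<Sum>i\<in>UNIV. (norm (column i (\<sigma> x)))\<^sup>2) \<le> T"
    and \<beta>: "\<And>x. x \<in> Q \<Longrightarrow> norm (\<beta> x) \<le> B"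
    and k: "0 \<le> k"
    and super: "\<And>x. x \<in> Q \<Longrightarrow> trace (diffmat \<sigma> x ** D2V x) / 2 + \<beta> x \<bullet> DV x - k * V x \<le> 0"
    and x: "x \<in> closure Q"
  shows "0 < V x"
proof -
  have Q: "open Q" "connected Q" using dom by (auto simp: C2_domain_def)
  have V: "C2_closure Q V DV D2V" using VG by (simp add: C2_gamma_def)
  have Vc: "continuous_on (closure Q) V" using V by (simp add: C2_closure_def)
  have sub: "Q \<subseteq> closure Q" by (rule closure_subset)
  have crit: "DV p = 0" if p: "p \<in> closure Q" "V p = 0" for p
  proof -
    have "0 < v \<bullet> (diffmat \<sigma> p *v v)" if "v \<noteq> 0" for v
      using m(2)[OF p(1), of v] m(1) that by (smt (verit) mult_pos_pos zero_less_norm_iff zero_less_power)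
    moreover have "V p \<le> V y" if "y \<in> closure Q" for y using nonneg[OF that] p(2) by simp
    ultimately show ?thesis using C2_gamma_min_point(1)[OF dom VG p(1)] by blast
  qed
  have noball: False if "0 < R" "ball y R \<subseteq> Q" "\<And>x. x \<in> ball y R \<Longrightarrow> 0 < V x" "dist y p = R" "V p = 0" for y R p
  proof -
    have "DV p \<noteq> 0"
      by (rule hopf_boundary_point[where Q = Q and V = V and DV = DV and ?D2V.0 = D2V and y = y and R = R and ?x0.0 = p and \<sigma> = \<sigma>
            and \<beta> = \<beta> and m = m and T = T and B = B and k = k])
        (use V nonneg m T \<beta> k super that sub in auto)
    moreover have "p \<in> closure Q"
      using closure_mono[OF that(2)] that(1,4) by auto
    ultimately show False using crit that(5) by blast
  qed
  define P where "P = {x \<in> Q. 0 < V x}"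
  have "continuous_on Q V" using Vc sub by (rule continuous_on_subset)
  then have "open P" unfolding P_def
    using continuous_open_preimage[of Q V "{0<..}"] Q(1) by (simp add: vimage_def Int_def conj_commute)
  have QP: "Q \<subseteq> P"
  proof (cases "\<exists>q\<in>Q. V q = 0 \<and> q \<in> closure P")
    case True
    then obtain q where q: "q \<in> Q" "V q = 0" "q \<in> closure P" by blast
    obtain d' where "d' > 0" and d': "ball q d' \<subseteq> Q" using Q(1) q(1) open_contains_ball by blast
    \<comment> \<open>Halving \<open>d'\<close> lets any \<open>y\<close> within \<open>d\<close> of
      \<open>q\<close> have its closed ball of radius \<open>d\<close> inside \<open>Q\<close>, with
      the zero \<open>q\<close> in that ball.\<close>
    define d where "d = d' / 2"
    have d: "d > 0" using \<open>d' > 0\<close> by (simp add: d_def)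
    obtain y where y: "y \<in> P" "dist y q < d" using q(3) d unfolding closure_approachable by blast
    have cb: "cball y d \<subseteq> Q"
    proof
      fix u assume "u \<in> cball y d"
      then have "dist q u < d'" using y(2) dist_triangle[of q u y] by (simp add: d_def dist_commute)
      then show "u \<in> Q" using d' by auto
    qed
    define Z where "Z = {u \<in> cball y d. V u = 0}"
    have "closed Z" unfolding Z_def
      using continuous_closed_preimage_constant[of "cball y d" V 0] continuous_on_subset[OF \<open>continuous_on Q V\<close> cb] by simp
    moreover have "q \<in> Z" using y(2) q(2) by (simp add: Z_def less_imp_le)
    \<comment> \<open>A zero nearest to \<open>y\<close> lies on the sphere of a ball centred at
      \<open>y\<close> on which \<open>V\<close> is positive, the configuration excluded by
      \<open>noball\<close>.\<close>
    ultimately obtain p where p: "p \<in> Z" "\<And>u. u \<in> Z \<Longrightarrow> dist y p \<le> dist y u"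
      using distance_attains_inf[of Z y] by blast
    define R where "R = dist y p"
    have "p \<noteq> y" using p(1) y(1) by (auto simp: Z_def P_def)
    then have R: "R > 0" by (simp add: R_def)
    have Rd: "R \<le> d" using p(1) by (simp add: R_def Z_def)
    have bQ: "ball y R \<subseteq> Q" using cb Rd by (auto simp: subset_eq)
    have pos: "0 < V u" if u: "u \<in> ball y R" for u
    proof (rule ccontr)
      assume "\<not> 0 < V u"
      moreover have "u \<in> Q" using bQ u by blast
      ultimately have "V u = 0" using nonneg[of u] sub by force
      then have "u \<in> Z" using u Rd by (auto simp: Z_def)
      then show False using p(2)[of u] u by (simp add: R_def)
    qed
    have "V p = 0" using p(1) by (simp add: Z_def)
    have False by (rule noball[OF R bQ pos R_def[symmetric] \<open>V p = 0\<close>])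
    then show ?thesis ..
  next
    case False
    \<comment> \<open>If no zero in \<open>Q\<close> is a limit of points of \<open>P\<close>, then
      \<open>P\<close> is relatively closed as well as open. Connectedness and the point
      \<open>q0\<close> leave no room for zeros.\<close>
    have "Q \<subseteq> P \<union> - closure P"
    proof
      fix u assume u: "u \<in> Q"
      then have "V u = 0 \<or> 0 < V u" using nonneg[of u] sub by force
      with u False show "u \<in> P \<union> - closure P" by (auto simp: P_def)
    qed
    moreover have "P \<inter> - closure P \<inter> Q = {}" using closure_subset[of P] by auto
    moreover have "P \<inter> Q \<noteq> {}" using ne by (auto simp: P_def)
    ultimately have "- closure P \<inter> Q = {}"
      using connectedD[OF Q(2) \<open>open P\<close>, of "- closure P"] by (auto simp: open_Compl)
    with \<open>Q \<subseteq> P \<union> - closure P\<close> show ?thesis by blast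
  qed
  show ?thesis
  proof (cases "x \<in> Q")
    case True then show ?thesis using QP by (auto simp: P_def)
  next
    case False
    then have "x \<in> frontier Q" using x Q(1) by (simp add: frontier_def interior_open)
    then obtain y R where R: "0 < R" "ball y R \<subseteq> Q" "dist y x = R" by (rule C2_domain_interior_ball[OF dom])
    show ?thesis
    proof (rule ccontr)
      assume "\<not> 0 < V x"
      then have "V x = 0" using nonneg[OF x] by simp
      moreover have "0 < V u" if "u \<in> ball y R" for u using that R(2) QP by (auto simp: P_def)
      ultimately show False using noball[of R y x] R by blast
    qed
  qed
qed

section \<open>The saddle point\<close>

lemma outer_product_mult: "(\<chi> i j. u $ i * v $ j) *v h = (v \<bullet> h) *\<^sub>R u" for u v h :: "real^'n"
  by (simp add: matrix_vector_mult_def vec_eq_iff inner_vec_def sum_distrib_left sum_distrib_right mult_ac)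

lemma C2_gamma_add:
  assumes "(f, Df, D2f) \<in> C2_gamma Q \<sigma>" "(g, Dg, D2g) \<in> C2_gamma Q \<sigma>"
  shows "((\<lambda>x. f x + g x), (\<lambda>x. Df x + Dg x), (\<lambda>x. D2f x + D2g x)) \<in> C2_gamma Q \<sigma>"
  using assms unfolding C2_gamma_def C2_closure_def
  by (auto intro!: continuous_intros derivative_eq_intros simp: inner_add_left matrix_vector_mult_add_rdistrib)

text \<open>The conormal condition survives because the new gradient is a multiple of
  \<open>DV\<close>. The rank-one correction of the Hessian later supplies the term that completes
  the square.\<close>

lemma C2_gamma_ln:
  fixes V :: "real^'n \<Rightarrow> real"
  assumes V: "(V, DV, D2V) \<in> C2_gamma Q \<sigma>" and pos: "\<And>x. x \<in> closure Q \<Longrightarrow> 0 < V x"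
  shows "((\<lambda>x. ln (V x)), (\<lambda>x. (1 / V x) *\<^sub>R DV x),
     (\<lambda>x. (1 / V x) *\<^sub>R D2V x - (1 / (V x)\<^sup>2) *\<^sub>R (\<chi> i j. DV x $ i * DV x $ j))) \<in> C2_gamma Q \<sigma>"
proof -
  have V': "continuous_on (closure Q) V" "continuous_on (closure Q) DV" "continuous_on (closure Q) D2V"
    "\<And>x. x \<in> Q \<Longrightarrow> (V has_derivative (\<lambda>h. DV x \<bullet> h)) (at x)"
    "\<And>x. x \<in> Q \<Longrightarrow> (DV has_derivative (\<lambda>h. D2V x *v h)) (at x)"
    and bc: "\<And>p v. outward_normal Q p v \<Longrightarrow> DV p \<bullet> (diffmat \<sigma> p *v v) = 0"
    using V by (auto simp: C2_gamma_def C2_closure_def)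
  have posQ: "0 < V x" if "x \<in> Q" for x using pos that closure_subset by blast
  have "((\<lambda>x. ln (V x)) has_derivative (\<lambda>h. ((1 / V x) *\<^sub>R DV x) \<bullet> h)) (at x)" if x: "x \<in> Q" for x
    using posQ[OF x] V'(4)[OF x] by (auto intro!: derivative_eq_intros simp: fun_eq_iff divide_inverse mult_ac)
  moreover have "((\<lambda>x. (1 / V x) *\<^sub>R DV x) has_derivative
      (\<lambda>h. ((1 / V x) *\<^sub>R D2V x - (1 / (V x)\<^sup>2) *\<^sub>R (\<chi> i j. DV x $ i * DV x $ j)) *v h)) (at x)" if x: "x \<in> Q" for x
  proof -
    have "((\<lambda>x. (1 / V x) *\<^sub>R DV x) has_derivative
        (\<lambda>h. (1 / V x) *\<^sub>R (D2V x *v h) + (- (DV x \<bullet> h) / (V x * V x)) *\<^sub>R DV x)) (at x)"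
      using posQ[OF x] V'(4)[OF x] V'(5)[OF x]
      by (auto intro!: derivative_eq_intros simp: fun_eq_iff divide_inverse)
    moreover have "((1 / V x) *\<^sub>R D2V x - (1 / (V x)\<^sup>2) *\<^sub>R (\<chi> i j. DV x $ i * DV x $ j)) *v h =
        (1 / V x) *\<^sub>R (D2V x *v h) + (- (DV x \<bullet> h) / (V x * V x)) *\<^sub>R DV x" for h
      by (simp add: matrix_vector_mult_diff_rdistrib matrix_vector_mult_scaleR_left outer_product_mult power2_eq_square)
    ultimately show ?thesis by simp
  qed
  moreover have "V x \<noteq> 0" if "x \<in> closure Q" for x using pos[OF that] by simp
  then have "continuous_on (closure Q) (\<lambda>x. ln (V x))" "continuous_on (closure Q) (\<lambda>x. (1 / V x) *\<^sub>R DV x)"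
    "continuous_on (closure Q) (\<lambda>x. (1 / V x) *\<^sub>R D2V x - (1 / (V x)\<^sup>2) *\<^sub>R (\<chi> i j. DV x $ i * DV x $ j))"
    using V'(1-3) by (auto intro!: continuous_intros continuous_on_vec_lambda)
  ultimately show ?thesis using bc unfolding C2_gamma_def C2_closure_def by (auto simp del: inner_scaleR_left) (simp add: bc)
qed

lemma continuous_on_trace_diffmat:
  assumes "continuous_on S \<sigma>" "continuous_on S A"
  shows "continuous_on S (\<lambda>x. trace (diffmat \<sigma> x ** A x))"
  unfolding trace_diffmat_mult column_def using assms
  by (intro continuous_intros continuous_on_mat_vec_mult continuous_on_vec_lambda)

lemma continuous_on_diffmat_mult:
  assumes "continuous_on S (\<lambda>x. \<sigma> (g x))" "continuous_on S v"
  shows "continuous_on S (\<lambda>x. diffmat \<sigma> (g x) *v v x)"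
  unfolding diffmat_def matrix_vector_mul_assoc[symmetric] transpose_def using assms
  by (intro continuous_intros continuous_on_mat_vec_mult continuous_on_vec_lambda)

lemma continuous_on_opA:
  fixes b :: "real^'n \<Rightarrow> 'k::topological_space \<Rightarrow> real^'n"
  assumes \<sigma>: "continuous_on (closure Q) \<sigma>" and b: "continuous_on (closure Q \<times> K) (\<lambda>(x, \<xi>). b x \<xi>)"
    and f: "(f, Df, D2f) \<in> C2_gamma Q \<sigma>"
  shows "continuous_on (closure Q \<times> K \<times> UNIV) (opA \<sigma> b Df D2f)"
proof -
  let ?S = "closure Q \<times> K \<times> (UNIV :: (real^'n) set)"
  have comp: "continuous_on ?S (\<lambda>z. g (fst z))" if "continuous_on (closure Q) g" for g :: "real^'n \<Rightarrow> 'b::topological_space"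
    by (rule continuous_on_compose2[OF that]) (auto intro!: continuous_intros)
  have D: "continuous_on (closure Q) Df" "continuous_on (closure Q) D2f"
    using f by (auto simp: C2_gamma_def C2_closure_def)
  have "continuous_on ?S (\<lambda>z. b (fst z) (fst (snd z)))"
  proof -
    have "continuous_on ?S (\<lambda>z. (fst z, fst (snd z)))" by (intro continuous_intros)
    then show ?thesis using continuous_on_compose2[OF b, of ?S "\<lambda>z. (fst z, fst (snd z))"] by force
  qed
  moreover have "continuous_on ?S (\<lambda>z. diffmat \<sigma> (fst z) *v snd (snd z))"
    by (intro continuous_on_diffmat_mult comp[OF \<sigma>] continuous_intros)
  ultimately have "continuous_on ?S (\<lambda>z. trace (diffmat \<sigma> (fst z) ** D2f (fst z)) / 2
      + (b (fst z) (fst (snd z)) + diffmat \<sigma> (fst z) *v snd (snd z)) \<bullet> Df (fst z))"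
    using comp[OF continuous_on_trace_diffmat[OF \<sigma> D(2)]] comp[OF D(1)] by (intro continuous_intros) auto
  then show ?thesis by (simp add: opA_def[abs_def] case_prod_beta)
qed

lemma continuous_on_runR:
  fixes c :: "real^'n \<Rightarrow> 'k::topological_space \<Rightarrow> real"
  assumes \<sigma>: "continuous_on (closure Q) \<sigma>" and c: "continuous_on (closure Q \<times> K) (\<lambda>(x, \<xi>). c x \<xi>)"
  shows "continuous_on (closure Q \<times> K \<times> UNIV) (runR \<sigma> c)"
proof -
  let ?S = "closure Q \<times> K \<times> (UNIV :: (real^'n) set)"
  have "continuous_on ?S (\<lambda>z. \<sigma> (fst z))"
    by (rule continuous_on_compose2[OF \<sigma>]) (auto intro!: continuous_intros)
  then have "continuous_on ?S (\<lambda>z. transpose (\<sigma> (fst z)) *v snd (snd z))"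
    unfolding transpose_def by (intro continuous_intros continuous_on_mat_vec_mult continuous_on_vec_lambda)
  moreover have "continuous_on ?S (\<lambda>z. c (fst z) (fst (snd z)))"
  proof -
    have "continuous_on ?S (\<lambda>z. (fst z, fst (snd z)))" by (intro continuous_intros)
    then show ?thesis using continuous_on_compose2[OF c, of ?S "\<lambda>z. (fst z, fst (snd z))"] by force
  qed
  ultimately have "continuous_on ?S (\<lambda>z. c (fst z) (fst (snd z)) - (norm (transpose (\<sigma> (fst z)) *v snd (snd z)))\<^sup>2 / 2)"
    by (intro continuous_intros) auto
  then show ?thesis by (simp add: runR_def[abs_def] case_prod_beta)
qed

lemma nn_integral_eint_parts:
  "(\<integral>\<^sup>+ z. ennreal (f z) * indicator S z \<partial>M) = (\<integral>\<^sup>+ z. ennreal (indicator S z *\<^sub>R f z) \<partial>M)"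
  by (rule nn_integral_cong) (simp add: indicator_def)

lemma eint_eq_set_integral:
  assumes "set_integrable M S f"
  shows "eint M S f = ereal (LINT z:S|M. f z)"
proof -
  let ?g = "\<lambda>z. indicator S z *\<^sub>R f z"
  have i: "integrable M ?g" using assms by (simp add: set_integrable_def)
  then have fin: "(\<integral>\<^sup>+ z. ennreal (?g z) \<partial>M) \<noteq> \<infinity>" "(\<integral>\<^sup>+ z. ennreal (- ?g z) \<partial>M) \<noteq> \<infinity>"
    by (auto simp: real_integrable_def)
  have e: "enn2ereal a - enn2ereal b = ereal (enn2real a - enn2real b)" if "a \<noteq> \<infinity>" "b \<noteq> \<infinity>" for a b
    using that by (cases a; cases b) auto
  show ?thesis
    unfolding eint_def nn_integral_eint_parts set_lebesgue_integral_def real_lebesgue_integral_def[OF i]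
    using e[OF fin] by (simp add: scaleR_minus_right)
qed

text \<open>An upper bound on a finite measure makes the positive part integrable, so only the
  negative part can diverge and the difference of infinities never arises. This covers measures
  under which the quadratic cost in \<open>y\<close> has infinite mean.\<close>

lemma eint_not_integrable:
  assumes M: "finite_measure M" and meas: "(\<lambda>z. indicator S z *\<^sub>R f z) \<in> borel_measurable M"
    and le: "\<And>z. z \<in> S \<Longrightarrow> f z \<le> C" and not: "\<not> set_integrable M S f"
  shows "eint M S f = - \<infinity>"
proof -
  interpret finite_measure M by fact
  let ?g = "\<lambda>z. indicator S z *\<^sub>R f z"
  have "(\<integral>\<^sup>+ z. ennreal (?g z) \<partial>M) \<le> (\<integral>\<^sup>+ z. ennreal \<bar>C\<bar> \<partial>M)"
    by (rule nn_integral_mono) (use le in \<open>force simp: indicator_def intro!: ennreal_leI\<close>)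
  also have "\<dots> < \<infinity>" by (simp add: emeasure_eq_measure flip: ennreal_mult)
  finally have fin: "(\<integral>\<^sup>+ z. ennreal (?g z) \<partial>M) \<noteq> \<infinity>" by simp
  then have inf: "(\<integral>\<^sup>+ z. ennreal (- ?g z) \<partial>M) = \<infinity>"
    using not meas by (auto simp: real_integrable_def set_integrable_def)
  have e: "enn2ereal a - enn2ereal \<infinity> = - \<infinity>" if "a \<noteq> \<infinity>" for a
    using that by (cases a) auto
  show ?thesis
    unfolding eint_def nn_integral_eint_parts using e[OF fin] inf by (simp add: scaleR_minus_right)
qed

lemma eint_le:
  assumes M: "prob_space M" and meas: "(\<lambda>z. indicator S z *\<^sub>R f z) \<in> borel_measurable M"
    and S: "S \<in> sets M" "emeasure M S = 1" and le: "\<And>z. z \<in> S \<Longrightarrow> f z \<le> C"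
  shows "eint M S f \<le> ereal C"
proof (cases "set_integrable M S f")
  case True
  interpret prob_space M by fact
  have iC: "set_integrable M S (\<lambda>_. C)" using S by (simp add: set_integrable_def)
  have "(LINT z:S|M. f z) \<le> (LINT z:S|M. C)" by (rule set_integral_mono[OF True iC le])
  also have "\<dots> = C" using S by (simp add: set_integral_const measure_def)
  finally show ?thesis using eint_eq_set_integral[OF True] by simp
next
  case False
  then show ?thesis using eint_not_integrable[OF _ meas le] M by (simp add: prob_space.finite_measure)
qed

text \<open>The integrands are unbounded in \<open>y\<close> on the full space, but a measure
  carried by a compact set only sees their bounded restriction.\<close>

lemma integral_carried_by_compact:
  fixes f :: "'a::metric_space \<Rightarrow> real"
  assumes \<nu>: "prob_space \<nu>" "sets \<nu> = sets borel" and M: "compact M" "emeasure \<nu> M = 1"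
    and S: "closed S" "M \<subseteq> S" and f: "continuous_on S f"
  shows "set_integrable \<nu> S f" "(LINT z:S|\<nu>. f z) = (LINT z:M|\<nu>. f z)"
proof -
  interpret prob_space \<nu> by fact
  have fM: "continuous_on M f" using f S(2) by (rule continuous_on_subset)
  have iM: "set_integrable \<nu> M f"
    by (rule set_integrable_continuous_on_compact[OF finite_measure_axioms \<nu>(2) M(1) fM])
  have bS: "S \<in> sets borel" using S(1) by (rule borel_closed)
  have bM: "M \<in> sets \<nu>" using M(1) \<nu>(2) by (simp add: borel_closed compact_imp_closed)
  have mS: "(\<lambda>z. indicator S z *\<^sub>R f z) \<in> borel_measurable \<nu>"
    using borel_measurable_continuous_on_indicator[OF bS f] by (simp add: measurable_cong_sets[OF \<nu>(2) refl])
  have mM: "(\<lambda>z. indicator M z *\<^sub>R f z) \<in> borel_measurable \<nu>" using iM by (auto simp: set_integrable_def)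
  have "AE z in \<nu>. z \<in> M" using AE_in_set_eq_1[OF bM] M(2) by (simp add: measure_def)
  then have ae: "AE z in \<nu>. indicator M z *\<^sub>R f z = indicator S z *\<^sub>R f z"
    by eventually_elim (use S(2) in \<open>auto simp: indicator_def\<close>)
  show "set_integrable \<nu> S f"
    using integrable_cong_AE_imp[OF _ mS ae] iM by (auto simp: set_integrable_def)
  show "(LINT z:S|\<nu>. f z) = (LINT z:M|\<nu>. f z)"
    unfolding set_lebesgue_integral_def using integral_cong_AE[OF mM mS ae] by simp
qed

text \<open>Testing with \<open>\<nu>\<close> bounds both values from below and testing with
  \<open>\<phi>\<close> bounds both from above. Only the lattice order is used, so infinite values
  of \<open>F\<close> do no harm.\<close>

lemma saddle_value:
  fixes F :: "'g \<Rightarrow> 'm \<Rightarrow> 'c::complete_lattice"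
  assumes "\<phi> \<in> G" "\<nu> \<in> X" and eq: "\<And>g. g \<in> G \<Longrightarrow> F g \<nu> = r" and le: "\<And>\<mu>. \<mu> \<in> X \<Longrightarrow> F \<phi> \<mu> \<le> r"
  shows "r = (INF g\<in>G. SUP \<mu>\<in>X. F g \<mu>)" "r = (SUP \<mu>\<in>X. INF g\<in>G. F g \<mu>)"
proof -
  show "r = (INF g\<in>G. SUP \<mu>\<in>X. F g \<mu>)"
  proof (rule antisym)
    show "r \<le> (INF g\<in>G. SUP \<mu>\<in>X. F g \<mu>)"
      by (rule INF_greatest) (metis SUP_upper assms(2) eq)
    show "(INF g\<in>G. SUP \<mu>\<in>X. F g \<mu>) \<le> r"
      by (rule INF_lower2[OF assms(1)]) (rule SUP_least[OF le])
  qed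
  show "r = (SUP \<mu>\<in>X. INF g\<in>G. F g \<mu>)"
  proof (rule antisym)
    show "r \<le> (SUP \<mu>\<in>X. INF g\<in>G. F g \<mu>)"
      by (rule SUP_upper2[OF assms(2)]) (rule INF_greatest, simp add: eq)
    show "(SUP \<mu>\<in>X. INF g\<in>G. F g \<mu>) \<le> r"
      by (rule SUP_least) (rule INF_lower2[OF assms(1)], rule le)
  qed
qed

text \<open>Completing the square in \<open>y\<close>: the optimal choice is \<open>y = \<nabla> ln V\<close>, and what remains is the
  eigenvalue equation divided by \<open>V\<close>.\<close>
lemma opA_ln_plus_runR:
  fixes b :: "real^'n \<Rightarrow> 'k \<Rightarrow> real^'n" and \<sigma> :: "real^'n \<Rightarrow> real^'n^'n"
  assumes pos: "0 < V x"
  shows "opA \<sigma> b (\<lambda>x. (1 / V x) *\<^sub>R DV x)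
      (\<lambda>x. (1 / V x) *\<^sub>R D2V x - (1 / (V x)\<^sup>2) *\<^sub>R (\<chi> i j. DV x $ i * DV x $ j)) (x, \<xi>, y) + runR \<sigma> c (x, \<xi>, y)
    = (trace (diffmat \<sigma> x ** D2V x) / 2 + (b x \<xi> \<bullet> DV x + c x \<xi> * V x)) / V x
      - (norm (transpose (\<sigma> x) *v (y - (1 / V x) *\<^sub>R DV x)))\<^sup>2 / 2"
proof -
  let ?s = "\<lambda>i. column i (\<sigma> x)"
  define d where "d = (1 / V x) *\<^sub>R DV x"
  have "trace (diffmat \<sigma> x ** ((1 / V x) *\<^sub>R D2V x - (1 / (V x)\<^sup>2) *\<^sub>R (\<chi> i j. DV x $ i * DV x $ j)))
      = (\<Sum>i\<in>UNIV. (1 / V x) * ((D2V x *v ?s i) \<bullet> ?s i) - (?s i \<bullet> d)\<^sup>2)"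
    unfolding trace_diffmat_mult
    by (intro sum.cong refl) (simp add: matrix_vector_mult_diff_rdistrib matrix_vector_mult_scaleR_left
        outer_product_mult inner_diff_left d_def power2_eq_square inner_commute[of _ "DV x"])
  also have "\<dots> = trace (diffmat \<sigma> x ** D2V x) / V x - (norm (transpose (\<sigma> x) *v d))\<^sup>2"
    unfolding norm_transpose_mult_eq_sum trace_diffmat_mult
    by (simp add: sum_subtractf sum_divide_distrib)
  finally have tr: "trace (diffmat \<sigma> x ** ((1 / V x) *\<^sub>R D2V x - (1 / (V x)\<^sup>2) *\<^sub>R (\<chi> i j. DV x $ i * DV x $ j)))
      = trace (diffmat \<sigma> x ** D2V x) / V x - (norm (transpose (\<sigma> x) *v d))\<^sup>2" .
  have cross: "(diffmat \<sigma> x *v y) \<bullet> d = (transpose (\<sigma> x) *v d) \<bullet> (transpose (\<sigma> x) *v y)"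
    by (subst inner_commute) (rule inner_diffmat)
  have square: "(norm (transpose (\<sigma> x) *v (y - d)))\<^sup>2 = (norm (transpose (\<sigma> x) *v y))\<^sup>2
      - 2 * ((transpose (\<sigma> x) *v d) \<bullet> (transpose (\<sigma> x) *v y)) + (norm (transpose (\<sigma> x) *v d))\<^sup>2"
    unfolding power2_norm_eq_inner
    by (simp add: matrix_vector_mult_diff_distrib inner_diff_left inner_diff_right inner_commute)
  have quot: "(trace (diffmat \<sigma> x ** D2V x) / 2 + (b x \<xi> \<bullet> DV x + c x \<xi> * V x)) / V x =
      trace (diffmat \<sigma> x ** D2V x) / V x / 2 + (b x \<xi> \<bullet> d + c x \<xi>)"
    using pos by (simp add: d_def field_simps)
  \<comment> \<open>Here \<open>N\<close> and \<open>Y\<close> are the squared norms for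
    \<open>d\<close> and \<open>y\<close>, and \<open>s\<close> is the cross term coming from the
    control drift. Together \<open>- N / 2 + s - Y / 2\<close> is minus half the square of the
    difference.\<close>
  have arith: "(\<tau> - N) / 2 + (p + s) + (q - Y / 2) = \<tau> / 2 + (p + q) - (Y - 2 * s + N) / 2" for \<tau> N p s q Y :: real
    by (simp add: field_simps)
  show ?thesis
    unfolding opA_def runR_def prod.case tr d_def[symmetric] inner_add_left quot cross square by (rule arith)
qed

theorem theorem2p2:
  fixes Q :: "(real^'n) set" and K :: "'k::metric_space set"
    and b :: "real^'n \<Rightarrow> 'k \<Rightarrow> real^'n" and c :: "real^'n \<Rightarrow> 'k \<Rightarrow> real"
    and \<sigma> :: "real^'n \<Rightarrow> real^'n^'n"
    and \<rho> :: real and V :: "real^'n \<Rightarrow> real" and DV :: "real^'n \<Rightarrow> real^'n"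
    and D2V :: "real^'n \<Rightarrow> real^'n^'n"
  assumes dom: "C2_domain Q" and bdd: "bounded Q" and zero: "0 \<in> Q"
    and K: "compact K" "K \<noteq> {}"
    and b_cont: "continuous_on (closure Q \<times> K) (\<lambda>(x, \<xi>). b x \<xi>)"
    and b_lip: "\<exists>L. \<forall>\<xi>\<in>K. \<forall>x\<in>closure Q. \<forall>y\<in>closure Q. norm (b x \<xi> - b y \<xi>) \<le> L * dist x y"
    and c_cont: "continuous_on (closure Q \<times> K) (\<lambda>(x, \<xi>). c x \<xi>)"
    and c_lip: "\<exists>L. \<forall>\<xi>\<in>K. \<forall>x\<in>closure Q. \<forall>y\<in>closure Q. \<bar>c x \<xi> - c y \<xi>\<bar> \<le> L * dist x y"
    and \<sigma>_C1: "\<exists>D\<sigma> :: real^'n \<Rightarrow> 'n \<Rightarrow> real^'n^'n. \<exists>\<alpha> H.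
        continuous_on (closure Q) \<sigma> \<and>
        (\<forall>x\<in>Q. (\<sigma> has_derivative (\<lambda>h. \<Sum>i\<in>UNIV. h $ i *\<^sub>R D\<sigma> x i)) (at x)) \<and>
        (\<forall>i. continuous_on (closure Q) (\<lambda>x. D\<sigma> x i)) \<and>
        0 < \<alpha> \<and> \<alpha> \<le> 1 \<and>
        (\<forall>i. \<forall>x\<in>closure Q. \<forall>y\<in>closure Q. norm (D\<sigma> x i - D\<sigma> y i) \<le> H * dist x y powr \<alpha>)"
    and ellip: "\<exists>m>0. \<forall>x\<in>Q. \<forall>e v. v \<noteq> 0 \<and> diffmat \<sigma> x *v v = e *\<^sub>R v \<longrightarrow> e \<ge> m"
    and V_C2: "(V, DV, D2V) \<in> C2_gamma Q \<sigma>"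
    and V_nonneg: "\<forall>x\<in>closure Q. V x \<ge> 0"
    and V_eig: "\<forall>x\<in>Q. trace (diffmat \<sigma> x ** D2V x) / 2
                 + (SUP \<xi>\<in>K. b x \<xi> \<bullet> DV x + c x \<xi> * V x) = \<rho> * V x"
    and V_norm: "V 0 = 1"
  shows "ereal \<rho> = (INF g\<in>C2_gamma Q \<sigma>. SUP \<mu>\<in>probs Q K. funcF Q K \<sigma> b c g \<mu>)
       \<and> ereal \<rho> = (SUP \<mu>\<in>probs Q K. INF g\<in>C2_gamma Q \<sigma>. funcF Q K \<sigma> b c g \<mu>)
       \<and> ereal \<rho> = (INF g\<in>C2_gamma Q \<sigma>. SUP \<mu>\<in>MAQ Q K \<sigma> b. funcF Q K \<sigma> b c g \<mu>)
       \<and> ereal \<rho> = (SUP \<mu>\<in>MAQ Q K \<sigma> b. INF g\<in>C2_gamma Q \<sigma>. funcF Q K \<sigma> b c g \<mu>)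
       \<and> ereal \<rho> = (SUP \<mu>\<in>MAQ Q K \<sigma> b. eint \<mu> (closure Q \<times> K \<times> UNIV) (runR \<sigma> c))"
proof -

  \<comment> \<open>Ellipticity and coefficient bounds on the closed domain\<close>
  let ?S = "closure Q \<times> K \<times> (UNIV :: (real^'n) set)"
  let ?T = "\<lambda>x. trace (diffmat \<sigma> x ** D2V x) / 2"
  have Q: "open Q" using dom by (simp add: C2_domain_def)
  have sub: "Q \<subseteq> closure Q" by (rule closure_subset)
  have cQ: "compact (closure Q)" using bdd by simp
  have \<sigma>c: "continuous_on (closure Q) \<sigma>" using \<sigma>_C1 by blast
  have V: "continuous_on (closure Q) V" "continuous_on (closure Q) DV" "continuous_on (closure Q) D2V"
    using V_C2 by (auto simp: C2_gamma_def C2_closure_def)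
  obtain m where m: "0 < m" and meig: "\<And>x e v. x \<in> Q \<Longrightarrow> v \<noteq> 0 \<Longrightarrow> diffmat \<sigma> x *v v = e *\<^sub>R v \<Longrightarrow> m \<le> e"
    using ellip by blast
  have mQ: "m * (norm v)\<^sup>2 \<le> v \<bullet> (diffmat \<sigma> x *v v)" if x: "x \<in> closure Q" for x v
  \<comment> \<open>Eigenvalues are controlled in \<open>Q\<close> only; the equivalent quadratic
    inequality is closed under limits and so reaches the boundary.\<close>
  proof (rule continuous_ge_on_closure[OF _ x])
    show "continuous_on (closure Q) (\<lambda>x. v \<bullet> (diffmat \<sigma> x *v v))"
      by (intro continuous_intros continuous_on_diffmat_mult \<sigma>c)
    show "m * (norm v)\<^sup>2 \<le> v \<bullet> (diffmat \<sigma> x *v v)" if "x \<in> Q" for x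
      by (rule diffmat_quadratic_lower_bound) (rule meig[OF that])
  qed
  have pd: "0 < v \<bullet> (diffmat \<sigma> x *v v)" if "x \<in> closure Q" "v \<noteq> 0" for x v
    using mQ[OF that(1), of v] m that(2) by (smt (verit) mult_pos_pos zero_less_norm_iff zero_less_power)
  have bd: "\<exists>B. \<forall>z\<in>X. norm (g z) \<le> B" if "compact X" "continuous_on X g"
    for X :: "'b::topological_space set" and g :: "'b \<Rightarrow> 'c::real_normed_vector"
    using compact_imp_bounded[OF compact_continuous_image[OF that(2,1)]] by (auto simp: bounded_iff)
  have cQK: "compact (closure Q \<times> K)" using cQ K(1) by (rule compact_Times)
  obtain B where B: "\<And>x \<xi>. x \<in> closure Q \<Longrightarrow> \<xi> \<in> K \<Longrightarrow> norm (b x \<xi>) \<le> B" using bd[OF cQK b_cont] by auto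
  obtain Cc where Cc: "\<And>x \<xi>. x \<in> closure Q \<Longrightarrow> \<xi> \<in> K \<Longrightarrow> \<bar>c x \<xi>\<bar> \<le> Cc" using bd[OF cQK c_cont] by auto
  have "continuous_on (closure Q) (\<lambda>x. \<Sum>i\<in>UNIV. (norm (column i (\<sigma> x)))\<^sup>2)"
    unfolding column_def using \<sigma>c by (intro continuous_intros continuous_on_vec_lambda)
  from bd[OF cQ this] obtain T where T: "\<And>x. x \<in> closure Q \<Longrightarrow> (\<Sum>i\<in>UNIV. (norm (column i (\<sigma> x)))\<^sup>2) \<le> T"
    by (auto simp: abs_le_iff)

  \<comment> \<open>Residual of the eigenvalue equation and its maximising controls\<close>
  define H where "H z = (case z of (x, \<xi>) \<Rightarrow> b x \<xi> \<bullet> DV x + c x \<xi> * V x)" for z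
  \<comment> \<open>The residual of the equation when the maximum is replaced by one control:
    nonpositive, and zero in \<open>Q\<close> exactly when that control is maximising.\<close>
  define G where "G z = ?T (fst z) + H z - \<rho> * V (fst z)" for z
  have comp: "continuous_on (closure Q \<times> K) (\<lambda>z. g (fst z))" if "continuous_on (closure Q) g"
    for g :: "real^'n \<Rightarrow> 'b::topological_space"
    by (rule continuous_on_compose2[OF that]) (auto intro!: continuous_intros)
  have Hc: "continuous_on (closure Q \<times> K) H"
    using b_cont c_cont comp[OF V(1)] comp[OF V(2)] unfolding H_def case_prod_beta by (intro continuous_intros)
  have Gc: "continuous_on (closure Q \<times> K) G"
    unfolding G_def using comp[OF V(1)] comp[OF continuous_on_trace_diffmat[OF \<sigma>c V(3)]] Hc by (intro continuous_intros) auto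
  have slice: "continuous_on K (\<lambda>\<xi>. H (x, \<xi>))" if "x \<in> closure Q" for x
    by (rule continuous_on_compose2[OF Hc]) (use that in \<open>auto intro!: continuous_intros\<close>)
  have GleQ: "G (x, \<xi>) \<le> 0" if "x \<in> Q" "\<xi> \<in> K" for x \<xi>
  proof -
    have "bdd_above ((\<lambda>\<xi>. H (x, \<xi>)) ` K)"
      using compact_imp_bounded[OF compact_continuous_image[OF slice K(1)]] that sub
      by (intro bounded_imp_bdd_above) auto
    from cSUP_upper[OF that(2) this] V_eig that(1) show ?thesis by (auto simp: G_def H_def)
  qed
  have Gle: "G (x, \<xi>) \<le> 0" if x: "x \<in> closure Q" and \<xi>: "\<xi> \<in> K" for x \<xi>
  proof (rule continuous_le_on_closure[OF _ x])
    show "continuous_on (closure Q) (\<lambda>x. G (x, \<xi>))"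
      by (rule continuous_on_compose2[OF Gc]) (use \<xi> in \<open>auto intro!: continuous_intros\<close>)
    show "G (x, \<xi>) \<le> 0" if "x \<in> Q" for x by (rule GleQ[OF that \<xi>])
  qed
  define E where "E = {z \<in> closure Q \<times> K. G z = 0}"
  have cE: "compact E"
  proof -
    have "closed E" unfolding E_def
      by (rule continuous_closed_preimage_constant[OF Gc]) (use cQK compact_imp_closed in blast)
    moreover have "E = (closure Q \<times> K) \<inter> E" by (auto simp: E_def)
    ultimately show ?thesis using compact_Int_closed[OF cQK] by metis
  qed
  \<comment> \<open>The equation is posed in \<open>Q\<close> only. Controls with zero residual over
    boundary points come from compactness, and they are needed because a test function may attain
    its minimum there.\<close>
  have Esurj: "closure Q \<subseteq> fst ` E"
  proof (rule closure_minimal)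
    show "closed (fst ` E)"
      by (intro compact_imp_closed compact_continuous_image cE continuous_intros)
    show "Q \<subseteq> fst ` E"
    proof
      fix x assume x: "x \<in> Q"
      then have xc: "x \<in> closure Q" using sub by blast
      obtain \<xi> where \<xi>: "\<xi> \<in> K" "\<And>\<eta>. \<eta> \<in> K \<Longrightarrow> H (x, \<eta>) \<le> H (x, \<xi>)"
        using continuous_attains_sup[OF K slice[OF xc]] by blast
      have "(SUP \<xi>\<in>K. H (x, \<xi>)) = H (x, \<xi>)" by (rule cSup_eq_maximum) (use \<xi> in auto)
      then have "G (x, \<xi>) = 0" using V_eig x by (auto simp: G_def H_def)
      then have "(x, \<xi>) \<in> E" using xc \<xi>(1) by (simp add: E_def)
      then show "x \<in> fst ` E" by force
    qed
  qed

  \<comment> \<open>Strict positivity of the eigenfunction\<close>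
  have pos: "0 < V x" if x: "x \<in> closure Q" for x
  proof -
    \<comment> \<open>Any fixed control turns the maximum into a linear inequality. The constant
      \<open>\<bar>\<rho>\<bar> + Cc\<close> dominates \<open>\<rho> - c y \<xi>0\<close>, which
      gives the zero-order term the sign that Hopf's lemma needs.\<close>
    obtain \<xi>0 where \<xi>0: "\<xi>0 \<in> K" using K(2) by blast
    have Cc0: "0 \<le> Cc" using Cc[OF x \<xi>0] by linarith
    show ?thesis
    proof (rule C2_gamma_supersolution_positive[OF dom V_C2 _ zero _ m mQ, where \<beta> = "\<lambda>x. b x \<xi>0" and B = B
          and T = T and k = "\<bar>\<rho>\<bar> + Cc"])
      show "0 \<le> \<bar>\<rho>\<bar> + Cc" using Cc0 by simp
      fix y assume y: "y \<in> Q"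
      then have yc: "y \<in> closure Q" using sub by blast
      have "?T y + b y \<xi>0 \<bullet> DV y + c y \<xi>0 * V y - \<rho> * V y \<le> 0"
        using GleQ[OF y \<xi>0] by (simp add: G_def H_def add.assoc)
      moreover have "(\<rho> - c y \<xi>0) * V y \<le> (\<bar>\<rho>\<bar> + Cc) * V y"
        using Cc[OF yc \<xi>0] V_nonneg yc by (intro mult_right_mono) auto
      ultimately show "?T y + b y \<xi>0 \<bullet> DV y - (\<bar>\<rho>\<bar> + Cc) * V y \<le> 0" by (simp add: algebra_simps)
    qed (use V_nonneg V_norm T B \<xi>0 sub x in auto)
  qed

  \<comment> \<open>Logarithmic transform and the contact set\<close>
  define d where "d x = (1 / V x) *\<^sub>R DV x" for x
  define D where "D x = (1 / V x) *\<^sub>R D2V x - (1 / (V x)\<^sup>2) *\<^sub>R (\<chi> i j. DV x $ i * DV x $ j)" for x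
  define \<phi> where "\<phi> = ((\<lambda>x. ln (V x)), d, D)"
  have \<phi>: "\<phi> \<in> C2_gamma Q \<sigma>"
    unfolding \<phi>_def d_def[abs_def] D_def[abs_def] using V_C2 pos by (rule C2_gamma_ln)
  have HJB: "opA \<sigma> b d D (x, \<xi>, y) + runR \<sigma> c (x, \<xi>, y) =
      \<rho> + G (x, \<xi>) / V x - (norm (transpose (\<sigma> x) *v (y - d x)))\<^sup>2 / 2" if "x \<in> closure Q" for x \<xi> y
    unfolding d_def[abs_def] D_def[abs_def] opA_ln_plus_runR[of V x, OF pos[OF that]]
    using pos[OF that] by (simp add: G_def H_def field_simps)
  have HJB_le: "opA \<sigma> b d D z + runR \<sigma> c z \<le> \<rho>" if "z \<in> ?S" for z
  proof -
    obtain x \<xi> y where z: "z = (x, \<xi>, y)" "x \<in> closure Q" "\<xi> \<in> K" using \<open>z \<in> ?S\<close> by auto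
    have "G (x, \<xi>) / V x \<le> 0" using Gle[OF z(2,3)] pos[OF z(2)] by (simp add: divide_nonpos_pos)
    then show ?thesis unfolding z(1) HJB[OF z(2)]
      using zero_le_power2[of "norm (transpose (\<sigma> x) *v (y - d x))"] by linarith
  qed
  \<comment> \<open>Setting the third coordinate to \<open>d x\<close> removes the square in
    \<open>HJB\<close>, and \<open>E\<close> removes the residual; continuity of \<open>d\<close>
    keeps the set compact.\<close>
  define M where "M = (\<lambda>z. (fst z, snd z, d (fst z))) ` E"
  have ES: "E \<subseteq> closure Q \<times> K" by (auto simp: E_def)
  have MS: "M \<subseteq> ?S" using ES by (auto simp: M_def)
  have dc: "continuous_on (closure Q) d" using \<phi> by (auto simp: \<phi>_def C2_gamma_def C2_closure_def)
  have cM: "compact M" unfolding M_def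
  proof (rule compact_continuous_image[OF _ cE])
    show "continuous_on E (\<lambda>z. (fst z, snd z, d (fst z)))"
      by (intro continuous_intros continuous_on_subset[OF comp[OF dc] ES])
  qed
  have HJB_eq: "opA \<sigma> b d D z + runR \<sigma> c z = \<rho>" if "z \<in> M" for z
    using that HJB by (auto simp: M_def E_def)
  have Sc: "closed ?S" using compact_imp_closed[OF K(1)] by (intro closed_Times) auto
  have opAc: "continuous_on ?S (opA \<sigma> b Df D2f)" if "(f, Df, D2f) \<in> C2_gamma Q \<sigma>" for f Df D2f
    by (rule continuous_on_opA[OF \<sigma>c b_cont that])
  have runRc: "continuous_on ?S (runR \<sigma> c)" by (rule continuous_on_runR[OF \<sigma>c c_cont])

  \<comment> \<open>The annihilating measure and its reward\<close>
  define W where "W = {opA \<sigma> b Df D2f | f Df D2f. (f, Df, D2f) \<in> C2_gamma Q \<sigma>}"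
  have "\<exists>\<nu>. prob_space \<nu> \<and> sets \<nu> = sets borel \<and> emeasure \<nu> M = 1 \<and> (\<forall>w\<in>W. (LINT z:M|\<nu>. w z) = 0)"
  proof (rule annihilating_probability_exists[OF cM, of W])
    show "W \<noteq> {}" using \<phi> by (auto simp: W_def \<phi>_def)
    show "continuous_on M w" if "w \<in> W" for w
      using that opAc continuous_on_subset[OF _ MS] by (auto simp: W_def)
    show "(\<lambda>z. w z + w' z) \<in> W" if wW: "w \<in> W" "w' \<in> W" for w w'
    proof -
      obtain f Df D2f f' Df' D2f' where f: "(f, Df, D2f) \<in> C2_gamma Q \<sigma>" "w = opA \<sigma> b Df D2f"
        and f': "(f', Df', D2f') \<in> C2_gamma Q \<sigma>" "w' = opA \<sigma> b Df' D2f'" using wW by (auto simp: W_def)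
      have "(\<lambda>z. w z + w' z) = opA \<sigma> b (\<lambda>x. Df x + Df' x) (\<lambda>x. D2f x + D2f' x)"
        by (auto simp: f f' fun_eq_iff opA_def matrix_add_ldistrib trace_add inner_add_right add_divide_distrib)
      with C2_gamma_add[OF f(1) f'(1)] show ?thesis unfolding W_def by blast
    qed
    show "(\<lambda>z. l * w z) \<in> W" if wW: "w \<in> W" for w l
    proof -
      obtain f Df D2f where f: "(f, Df, D2f) \<in> C2_gamma Q \<sigma>" "w = opA \<sigma> b Df D2f" using wW by (auto simp: W_def)
      have "(\<lambda>z. l * w z) = opA \<sigma> b (\<lambda>x. l *\<^sub>R Df x) (\<lambda>x. l *\<^sub>R D2f x)"
        by (auto simp: f fun_eq_iff opA_def trace_diffmat_mult matrix_vector_mult_scaleR_left sum_distrib_left algebra_simps)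
      with C2_gamma_scale[OF f(1), of l] show ?thesis unfolding W_def by blast
    qed
    show "\<exists>z\<in>M. 0 \<le> w z" if wW: "w \<in> W" for w
    proof -
      obtain f Df D2f where f: "(f, Df, D2f) \<in> C2_gamma Q \<sigma>" "w = opA \<sigma> b Df D2f" using wW by (auto simp: W_def)
      have "continuous_on (closure Q) f" using f(1) by (auto simp: C2_gamma_def C2_closure_def)
      then obtain p where p: "p \<in> closure Q" "\<And>x. x \<in> closure Q \<Longrightarrow> f p \<le> f x"
        using continuous_attains_inf[OF cQ, of f] zero sub by blast
      \<comment> \<open>A vanishing gradient cancels the drift whatever the control and
        \<open>y\<close> are, so every point of \<open>M\<close> over \<open>p\<close> will do;
        \<open>Esurj\<close> supplies one.\<close>
      have "Df p = 0" "0 \<le> trace (diffmat \<sigma> p ** D2f p)"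
        using C2_gamma_min_point[OF dom f(1) p(1) pd[OF p(1)]] p(2) by auto
      moreover obtain \<xi> where "(p, \<xi>) \<in> E" using Esurj p(1) by force
      then have "(p, \<xi>, d p) \<in> M" by (force simp: M_def)
      ultimately show ?thesis by (intro bexI[of _ "(p, \<xi>, d p)"]) (auto simp: f opA_def)
    qed
  qed blast
  then obtain \<nu> where \<nu>: "prob_space \<nu>" "sets \<nu> = sets borel" "emeasure \<nu> M = 1"
    and ann: "\<And>f Df D2f. (f, Df, D2f) \<in> C2_gamma Q \<sigma> \<Longrightarrow> (LINT z:M|\<nu>. opA \<sigma> b Df D2f z) = 0"
    unfolding W_def by blast
  note carried = integral_carried_by_compact[OF \<nu>(1,2) cM \<nu>(3) Sc MS]
  interpret \<nu>: prob_space \<nu> by fact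
  have \<nu>S: "emeasure \<nu> ?S = 1"
  proof (rule antisym[OF \<nu>.emeasure_le_1])
    have "?S \<in> sets \<nu>" unfolding \<nu>(2) by (rule borel_closed[OF Sc])
    from emeasure_mono[OF MS this] show "1 \<le> emeasure \<nu> ?S" unfolding \<nu>(3) .
  qed
  have \<nu>P: "\<nu> \<in> probs Q K" unfolding probs_def using \<nu>(2) \<nu>S \<nu>.emeasure_space_1 by blast
  have \<nu>int: "set_integrable \<nu> ?S (opA \<sigma> b Df D2f)" "(LINT z:?S|\<nu>. opA \<sigma> b Df D2f z) = 0"
    if f: "(f, Df, D2f) \<in> C2_gamma Q \<sigma>" for f Df D2f
    using carried[OF opAc[OF f]] ann[OF f] by simp_all
  have \<nu>A: "\<nu> \<in> MAQ Q K \<sigma> b"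
    unfolding MAQ_def using \<nu>P \<nu>int by blast
  \<comment> \<open>Since \<open>\<nu>\<close> annihilates \<A>\<phi>, adding it to the integrand
    changes nothing, and the sum is constantly \<open>\<rho>\<close> on \<open>M\<close>.\<close>
  have runR_int: "(LINT z:?S|\<nu>. runR \<sigma> c z) = \<rho>"
  proof -
    have \<phi>': "((\<lambda>x. ln (V x)), d, D) \<in> C2_gamma Q \<sigma>" using \<phi> by (simp add: \<phi>_def)
    have iM: "set_integrable \<nu> M g" if "continuous_on ?S g" for g :: "_ \<Rightarrow> real"
      by (rule set_integrable_continuous_on_compact[OF \<nu>.finite_measure_axioms \<nu>(2) cM continuous_on_subset[OF that MS]])
    have "(LINT z:M|\<nu>. runR \<sigma> c z) = (LINT z:M|\<nu>. opA \<sigma> b d D z + runR \<sigma> c z)"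
      using ann[OF \<phi>'] set_integral_add(2)[OF iM[OF opAc[OF \<phi>']] iM[OF runRc]] by simp
    also have "\<dots> = (LINT z:M|\<nu>. \<rho>)"
      by (rule set_lebesgue_integral_cong) (use HJB_eq cM \<nu>(2) in \<open>auto simp: borel_closed compact_imp_closed\<close>)
    also have "\<dots> = \<rho>" using cM \<nu>(2,3) by (simp add: set_integral_const borel_closed compact_imp_closed measure_def)
    finally show ?thesis using carried(2)[OF runRc] by simp
  qed
  have F\<nu>: "funcF Q K \<sigma> b c g \<nu> = ereal \<rho>" if g: "g \<in> C2_gamma Q \<sigma>" for g
  proof -
    obtain f Df D2f where f: "g = (f, Df, D2f)" by (cases g)
    note i = \<nu>int(1)[OF g[unfolded f]] carried(1)[OF runRc]
    show ?thesis
      unfolding funcF_def f using \<nu>int(2)[OF g[unfolded f]] eint_eq_set_integral[OF set_integral_add(1)[OF i]] set_integral_add(2)[OF i] runR_int by simp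
  qed

  \<comment> \<open>Upper bounds for arbitrary measures\<close>
  have meas: "(\<lambda>z. indicator ?S z *\<^sub>R g z) \<in> borel_measurable \<mu>" "?S \<in> sets \<mu>" "prob_space \<mu>" "emeasure \<mu> ?S = 1"
    if "\<mu> \<in> probs Q K" "continuous_on ?S g" for \<mu> and g :: "_ \<Rightarrow> real"
  proof -
    have s: "sets \<mu> = sets borel" using that by (simp add: probs_def)
    show "(\<lambda>z. indicator ?S z *\<^sub>R g z) \<in> borel_measurable \<mu>"
      using borel_measurable_continuous_on_indicator[OF borel_closed[OF Sc] that(2)] by (simp add: measurable_cong_sets[OF s refl])
    show "?S \<in> sets \<mu>" "prob_space \<mu>" "emeasure \<mu> ?S = 1"
      using that Sc s by (auto simp: probs_def borel_closed intro: prob_spaceI)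
  qed
  have F\<phi>: "funcF Q K \<sigma> b c \<phi> \<mu> \<le> ereal \<rho>" if "\<mu> \<in> probs Q K" for \<mu>
  proof -
    have "continuous_on ?S (\<lambda>z. opA \<sigma> b d D z + runR \<sigma> c z)"
      using opAc \<phi> runRc by (auto simp: \<phi>_def intro!: continuous_intros)
    note meas' = meas[OF that this]
    show ?thesis unfolding funcF_def \<phi>_def prod.case
      by (rule eint_le[OF meas'(3) meas'(1) meas'(2) meas'(4)]) (rule HJB_le)
  qed
  have AP: "\<mu> \<in> probs Q K" if "\<mu> \<in> MAQ Q K \<sigma> b" for \<mu> using that by (simp add: MAQ_def)
  \<comment> \<open>If the reward is integrable, \<A>\<phi> can be added at no cost and
    \<open>F\<phi>\<close> applies. Otherwise the bound \<open>Cc\<close> from above makes the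
    extended integral minus infinity.\<close>
  have R\<mu>: "eint \<mu> ?S (runR \<sigma> c) \<le> ereal \<rho>" if \<mu>: "\<mu> \<in> MAQ Q K \<sigma> b" for \<mu>
  proof (cases "set_integrable \<mu> ?S (runR \<sigma> c)")
    case True
    have A: "set_integrable \<mu> ?S (opA \<sigma> b d D)" "(LINT z:?S|\<mu>. opA \<sigma> b d D z) = 0"
      using \<mu> \<phi> by (auto simp: MAQ_def \<phi>_def)
    have "eint \<mu> ?S (runR \<sigma> c) = eint \<mu> ?S (\<lambda>z. opA \<sigma> b d D z + runR \<sigma> c z)"
      using eint_eq_set_integral[OF True] eint_eq_set_integral[OF set_integral_add(1)[OF A(1) True]]
        set_integral_add(2)[OF A(1) True] A(2) by simp
    also have "\<dots> \<le> ereal \<rho>" using F\<phi>[OF AP[OF \<mu>]] by (simp add: funcF_def \<phi>_def)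
    finally show ?thesis .
  next
    case False
    note meas' = meas[OF AP[OF \<mu>] runRc]
    have "runR \<sigma> c z \<le> Cc" if "z \<in> ?S" for z
      using that Cc by (auto simp: runR_def) (smt (verit) zero_le_power2 divide_nonneg_pos)
    then show ?thesis
      using eint_not_integrable[OF prob_space.finite_measure[OF meas'(3)] meas'(1) _ False, of Cc] by simp
  qed
  have "ereal \<rho> = (SUP \<mu>\<in>MAQ Q K \<sigma> b. eint \<mu> ?S (runR \<sigma> c))"
  proof (rule antisym)
    have "eint \<nu> ?S (runR \<sigma> c) = ereal \<rho>"
      using eint_eq_set_integral[OF carried(1)[OF runRc]] runR_int by simp
    then show "ereal \<rho> \<le> (SUP \<mu>\<in>MAQ Q K \<sigma> b. eint \<mu> ?S (runR \<sigma> c))" using SUP_upper[OF \<nu>A] by metis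
    show "(SUP \<mu>\<in>MAQ Q K \<sigma> b. eint \<mu> ?S (runR \<sigma> c)) \<le> ereal \<rho>" by (rule SUP_least[OF R\<mu>])
  qed
  moreover note saddle_value[where F = "funcF Q K \<sigma> b c" and r = "ereal \<rho>", OF \<phi> \<nu>P F\<nu> F\<phi>]
    saddle_value[where F = "funcF Q K \<sigma> b c" and r = "ereal \<rho>", OF \<phi> \<nu>A F\<nu> F\<phi>[OF AP]]
  ultimately show ?thesis by blast
qed

end
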